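(* Let $\kappa$ be a cardinal. (i) $\kappa$ is uncountable and regular if and only if for all sufficiently large cardinals $\theta$, there is a small embedding $j:M\longrightarrow \mathrm{H}(\theta)$ for $\kappa$. (ii) $\kappa$ is weakly inaccessible if and only if for all sufficiently large cardinals $\theta$, there is a small embedding $j:M\longrightarrow \mathrm{H}(\theta)$ for $\kappa$ such that $\mathrm{crit}(j)$ is a cardinal. (iii) $\kappa$ is inaccessible if and only if for all sufficiently large cardinals $\theta$, there is a small embedding $j:M\longrightarrow \mathrm{H}(\theta)$ for $\kappa$ such that $\mathrm{crit}(j)$ is a strong limit cardinal. (iv) $\kappa$ is weakly Mahlo if and only if for all sufficiently large cardinals $\theta$, there is a small embedding $j:M\longrightarrow \mathrm{H}(\theta)$ for $\kappa$ such that $\mathrm{crit}(j)$ is a regular cardinal. (v) $\kappa$ is Mahlo if and only if for all sufficiently large cardinals $\theta$, there is a small embedding $j:M\longrightarrow \mathrm{H}(\theta)$ for $\kappa$ such that $\mathrm{crit}(j)$ is an inaccessible cardinal.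
   Context: $\mathrm{H}(\theta)$ is the set of all sets whose transitive closure has cardinality less than $\theta$. An elementary embedding $j:M\to N$ between transitive classes is non-trivial if there is an ordinal $\alpha\in M$ with $j(\alpha)>\alpha$; then $\mathrm{crit}(j)$ denotes the least such ordinal. Given cardinals $\kappa<\theta$, a non-trivial elementary embedding $j:M\to \mathrm{H}(\theta)$ is a small embedding for $\kappa$ if $M\in \mathrm{H}(\theta)$ is transitive and $j(\mathrm{crit}(j))=\kappa$. "For all sufficiently large cardinals $\theta$" means: there is an ordinal $\alpha\geq\kappa$ such that the statement holds for all cardinals $\theta>\alpha$. The properties of $\mathrm{crit}(j)$ (being a cardinal, strong limit, regular, inaccessible) are evaluated in $\mathrm{V}$. Weakly inaccessible means uncountable regular limit cardinal; weakly Mahlo (respectively Mahlo) means regular uncountable with the set of regular (respectively inaccessible) cardinals below it stationary. *)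

theory Defs
  imports "HOL-Library.Equipollence"
begin

text \<open>
  The type \<open>'a\<close> is the set-theoretic universe and \<open>elts x\<close> is the extension of the set \<open>x\<close>;
  \<open>x \<in> elts y\<close> renders the membership relation. Separation and replacement are stated for
  arbitrary predicates and functions of the logic. Consequently every function defined on
  \<open>elts x\<close> has a graph that is an element of the universe, so functions between sets of the
  universe may be rendered as functions of the logic restricted to \<open>elts x\<close>.
\<close>

class zfc =
  fixes elts :: "'a \<Rightarrow> 'a set"
  assumes extensionality: "elts x = elts y \<Longrightarrow> x = y"
    and foundation: "elts x \<noteq> {} \<Longrightarrow> \<exists>y\<in>elts x. elts y \<inter> elts x = {}"
    and pairing: "\<exists>z. elts z = {x, y}"
    and union: "\<exists>u. elts u = (\<Union>y\<in>elts x. elts y)"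
    and power_set: "\<exists>p. elts p = {y. elts y \<subseteq> elts x}"
    and infinity: "\<exists>w. (\<exists>e\<in>elts w. elts e = {}) \<and>
                        (\<forall>x\<in>elts w. \<exists>s\<in>elts w. elts s = insert x (elts x))"
    and separation: "\<exists>y. elts y = {z \<in> elts x. P z}"
    and replacement: "\<exists>y. elts y = F ` elts x"
    and choice: "\<lbrakk>\<forall>y\<in>elts x. elts y \<noteq> {};
                  \<forall>y\<in>elts x. \<forall>z\<in>elts x. y \<noteq> z \<longrightarrow> elts y \<inter> elts z = {}\<rbrakk>
                 \<Longrightarrow> \<exists>c. \<forall>y\<in>elts x. \<exists>!z. z \<in> elts c \<inter> elts y"


subsection \<open>Ordinals and cardinals\<close>

definition transitive_class :: "'a::zfc set \<Rightarrow> bool" where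
  "transitive_class A \<longleftrightarrow> (\<forall>x\<in>A. elts x \<subseteq> A)"

definition Ord :: "'a::zfc \<Rightarrow> bool" where
  "Ord \<alpha> \<longleftrightarrow> transitive_class (elts \<alpha>) \<and> (\<forall>\<beta>\<in>elts \<alpha>. transitive_class (elts \<beta>))"

text \<open>The ordering of the ordinals: \<open>\<alpha> < \<beta>\<close> is \<open>\<alpha> \<in> elts \<beta>\<close>.\<close>

definition ord_le :: "'a::zfc \<Rightarrow> 'a \<Rightarrow> bool" where
  "ord_le \<alpha> \<beta> \<longleftrightarrow> \<alpha> \<in> elts \<beta> \<or> \<alpha> = \<beta>"

definition least_Ord :: "('a::zfc \<Rightarrow> bool) \<Rightarrow> 'a" where
  "least_Ord P = (THE \<alpha>. Ord \<alpha> \<and> P \<alpha> \<and> (\<forall>\<beta>\<in>elts \<alpha>. \<not> P \<beta>))"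

definition Card :: "'a::zfc \<Rightarrow> bool" where
  "Card \<kappa> \<longleftrightarrow> Ord \<kappa> \<and> (\<forall>\<alpha>\<in>elts \<kappa>. \<not> elts \<alpha> \<approx> elts \<kappa>)"

definition cofinality :: "'a::zfc \<Rightarrow> 'a" where
  "cofinality \<gamma> = least_Ord (\<lambda>\<alpha>. \<exists>f. f ` elts \<alpha> \<subseteq> elts \<gamma> \<and>
     (\<forall>\<beta>\<in>elts \<gamma>. \<exists>\<xi>\<in>elts \<alpha>. ord_le \<beta> (f \<xi>)))"

definition regular_cardinal :: "'a::zfc \<Rightarrow> bool" where
  "regular_cardinal \<kappa> \<longleftrightarrow> Card \<kappa> \<and> infinite (elts \<kappa>) \<and> cofinality \<kappa> = \<kappa>"

definition limit_cardinal :: "'a::zfc \<Rightarrow> bool" where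
  "limit_cardinal \<kappa> \<longleftrightarrow> Card \<kappa> \<and> infinite (elts \<kappa>) \<and>
     (\<forall>\<mu>\<in>elts \<kappa>. Card \<mu> \<longrightarrow> (\<exists>\<nu>\<in>elts \<kappa>. Card \<nu> \<and> \<mu> \<in> elts \<nu>))"

text \<open>By separation, \<open>Pow (elts \<mu>)\<close> is in bijection with the power set of \<open>\<mu>\<close> in the universe.\<close>

definition strong_limit_cardinal :: "'a::zfc \<Rightarrow> bool" where
  "strong_limit_cardinal \<kappa> \<longleftrightarrow> Card \<kappa> \<and> infinite (elts \<kappa>) \<and>
     (\<forall>\<mu>\<in>elts \<kappa>. Card \<mu> \<longrightarrow> Pow (elts \<mu>) \<prec> elts \<kappa>)"

definition weakly_inaccessible :: "'a::zfc \<Rightarrow> bool" where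
  "weakly_inaccessible \<kappa> \<longleftrightarrow>
     uncountable (elts \<kappa>) \<and> regular_cardinal \<kappa> \<and> limit_cardinal \<kappa>"

definition inaccessible :: "'a::zfc \<Rightarrow> bool" where
  "inaccessible \<kappa> \<longleftrightarrow>
     uncountable (elts \<kappa>) \<and> regular_cardinal \<kappa> \<and> strong_limit_cardinal \<kappa>"

definition limit_Ord :: "'a::zfc \<Rightarrow> bool" where
  "limit_Ord \<gamma> \<longleftrightarrow> Ord \<gamma> \<and> elts \<gamma> \<noteq> {} \<and> (\<forall>\<alpha>\<in>elts \<gamma>. \<exists>\<beta>\<in>elts \<gamma>. \<alpha> \<in> elts \<beta>)"

definition unbounded_in :: "'a::zfc set \<Rightarrow> 'a \<Rightarrow> bool" where
  "unbounded_in C \<gamma> \<longleftrightarrow> (\<forall>\<alpha>\<in>elts \<gamma>. \<exists>\<beta>\<in>C \<inter> elts \<gamma>. \<alpha> \<in> elts \<beta>)"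

definition club_in :: "'a::zfc set \<Rightarrow> 'a \<Rightarrow> bool" where
  "club_in C \<kappa> \<longleftrightarrow> C \<subseteq> elts \<kappa> \<and> unbounded_in C \<kappa> \<and>
     (\<forall>\<gamma>\<in>elts \<kappa>. limit_Ord \<gamma> \<and> unbounded_in C \<gamma> \<longrightarrow> \<gamma> \<in> C)"

definition stationary_in :: "'a::zfc set \<Rightarrow> 'a \<Rightarrow> bool" where
  "stationary_in S \<kappa> \<longleftrightarrow> S \<subseteq> elts \<kappa> \<and> (\<forall>C. club_in C \<kappa> \<longrightarrow> S \<inter> C \<noteq> {})"

definition weakly_Mahlo :: "'a::zfc \<Rightarrow> bool" where
  "weakly_Mahlo \<kappa> \<longleftrightarrow> uncountable (elts \<kappa>) \<and> regular_cardinal \<kappa> \<and>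
     stationary_in {\<mu> \<in> elts \<kappa>. regular_cardinal \<mu>} \<kappa>"

definition Mahlo :: "'a::zfc \<Rightarrow> bool" where
  "Mahlo \<kappa> \<longleftrightarrow> uncountable (elts \<kappa>) \<and> regular_cardinal \<kappa> \<and>
     stationary_in {\<mu> \<in> elts \<kappa>. inaccessible \<mu>} \<kappa>"


subsection \<open>The sets \<open>H(\<theta>)\<close>\<close>

definition transitive_closure :: "'a::zfc \<Rightarrow> 'a set" where
  "transitive_closure x = \<Inter>{elts t | t. transitive_class (elts t) \<and> elts x \<subseteq> elts t}"

definition H :: "'a::zfc \<Rightarrow> 'a set" where
  "H \<theta> = {x. transitive_closure x \<prec> elts \<theta>}"


subsection \<open>Elementary embeddings\<close>

text \<open>First-order formulas in the language of set theory, with variables named by numbers.\<close>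

datatype fm = Mem nat nat | Equal nat nat | Neg fm | Conj fm fm | Exists nat fm

primrec sat :: "'a::zfc set \<Rightarrow> fm \<Rightarrow> (nat \<Rightarrow> 'a) \<Rightarrow> bool" where
  "sat A (Mem m n) e \<longleftrightarrow> e m \<in> elts (e n)"
| "sat A (Equal m n) e \<longleftrightarrow> e m = e n"
| "sat A (Neg \<phi>) e \<longleftrightarrow> \<not> sat A \<phi> e"
| "sat A (Conj \<phi> \<psi>) e \<longleftrightarrow> sat A \<phi> e \<and> sat A \<psi> e"
| "sat A (Exists n \<phi>) e \<longleftrightarrow> (\<exists>x\<in>A. sat A \<phi> (e(n := x)))"

text \<open>An embedding \<open>j\<close> of \<open>A\<close> into \<open>B\<close> is relevant only through its values on \<open>A\<close>.\<close>

definition elementary_embedding :: "'a::zfc set \<Rightarrow> 'a set \<Rightarrow> ('a \<Rightarrow> 'a) \<Rightarrow> bool" where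
  "elementary_embedding A B j \<longleftrightarrow> j ` A \<subseteq> B \<and>
     (\<forall>\<phi> e. range e \<subseteq> A \<longrightarrow> (sat A \<phi> e \<longleftrightarrow> sat B \<phi> (j \<circ> e)))"

definition nontrivial_embedding :: "'a::zfc set \<Rightarrow> ('a \<Rightarrow> 'a) \<Rightarrow> bool" where
  "nontrivial_embedding A j \<longleftrightarrow> (\<exists>\<alpha>\<in>A. Ord \<alpha> \<and> \<alpha> \<in> elts (j \<alpha>))"

definition crit :: "'a::zfc set \<Rightarrow> ('a \<Rightarrow> 'a) \<Rightarrow> 'a" where
  "crit A j = least_Ord (\<lambda>\<alpha>. \<alpha> \<in> A \<and> \<alpha> \<in> elts (j \<alpha>))"

definition small_embedding :: "'a::zfc \<Rightarrow> 'a \<Rightarrow> 'a \<Rightarrow> ('a \<Rightarrow> 'a) \<Rightarrow> bool" where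
  "small_embedding \<kappa> \<theta> M j \<longleftrightarrow>
     Card \<kappa> \<and> Card \<theta> \<and> \<kappa> \<in> elts \<theta> \<and>
     M \<in> H \<theta> \<and> transitive_class (elts M) \<and>
     elementary_embedding (elts M) (H \<theta>) j \<and> nontrivial_embedding (elts M) j \<and>
     j (crit (elts M) j) = \<kappa>"

definition for_large_cardinals :: "'a::zfc \<Rightarrow> ('a \<Rightarrow> bool) \<Rightarrow> bool" where
  "for_large_cardinals \<kappa> P \<longleftrightarrow>
     (\<exists>\<alpha>. Ord \<alpha> \<and> ord_le \<kappa> \<alpha> \<and> (\<forall>\<theta>. Card \<theta> \<and> \<alpha> \<in> elts \<theta> \<longrightarrow> P \<theta>))"

end

theory Submission
  imports Defs "HOL-Library.Countable"
begin

text \<open>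
  From left to right, let \<open>X\<^sub>\<alpha>\<close> be the Skolem hull of \<open>\<alpha> \<union> {\<kappa>}\<close> in \<open>H(\<theta>)\<close>. Since \<open>\<kappa>\<close> is regular and
  uncountable, the \<open>\<alpha> < \<kappa>\<close> with \<open>X\<^sub>\<alpha> \<inter> \<kappa> = \<alpha>\<close> include the closure points of a function \<open>\<kappa> \<rightarrow> \<kappa>\<close>, which
  form a club, and for these \<open>\<alpha>\<close> the inverse of the Mostowski collapse of \<open>X\<^sub>\<alpha>\<close> is a small embedding
  with critical point \<open>\<alpha>\<close>. The extra property of \<open>\<kappa>\<close> yields such an \<open>\<alpha>\<close> with the required property.

  From right to left, suppose that \<open>\<kappa>\<close> fails the property in question. For \<open>\<theta>\<close> large, \<open>H(\<theta>)\<close> contains a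
  witness of the failure (a short cofinal map, injections into a smaller ordinal or into its power
  set, a club of bad points), so \<open>M\<close> contains a witness \<open>F\<close> for \<open>crit(j)\<close>. As \<open>j\<close> fixes the ordinals
  below \<open>crit(j)\<close>, comparing \<open>F\<close> with \<open>j(F)\<close> at the point \<open>crit(j) < \<kappa>\<close> contradicts the property of
  \<open>crit(j)\<close>.
\<close>


section \<open>Sets and classes\<close>

text \<open>The properties of crit(j) hold in V, and M need not contain what verifies or refutes
  them. So it is never asked whether M evaluates such a property of \<open>\<alpha>\<close>
  correctly. Either a code found in M is a real one, because being a code is a bounded condition and
  hence absolute, or a statement about \<open>\<alpha>\<close> is carried by j to H(\<theta>) and
  read there at the point \<open>\<alpha>\<close> < \<kappa>, whose codes lie in H(\<theta>) once
  \<theta> is larger than \<kappa> and P(\<kappa>). This is why properties are treated through their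
  failures, why only quantifiers over codes and clubs are unbounded, and why these objects are
  subsets of \<kappa> or of P(\<kappa>). In the other direction a hull is formed over each b + 1
  with b < \<kappa>: its size is below \<kappa>, so regularity gives a bound h(b) for its ordinals
  below \<kappa>. The requirement on \<alpha> thereby becomes closure under one function h from
  \<kappa> to \<kappa>, and any kind of point that occurs among the closure points of every such h
  can serve as critical point.\<close>

definition small :: "'a::zfc set \<Rightarrow> bool" where
  "small X \<longleftrightarrow> (\<exists>x. elts x = X)"

definition vset :: "'a::zfc set \<Rightarrow> 'a" where
  "vset X = (SOME x. elts x = X)"

lemma elts_vset [simp]: "small X \<Longrightarrow> elts (vset X) = X"
  unfolding small_def vset_def by (rule someI_ex)

lemma small_elts [iff]: "small (elts x)"
  by (auto simp: small_def)

lemma small_image: "small X \<Longrightarrow> small (f ` X :: 'a set)" for X :: "'a::zfc set"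
  using replacement[of f] unfolding small_def by blast

lemma small_subset: "small X \<Longrightarrow> Y \<subseteq> X \<Longrightarrow> small Y"
proof -
  assume "small X" "Y \<subseteq> X"
  then obtain x where x: "elts x = X" by (auto simp: small_def)
  obtain y where "elts y = {z \<in> elts x. z \<in> Y}" using separation[of x "\<lambda>z. z \<in> Y"] by auto
  with x \<open>Y \<subseteq> X\<close> show "small Y" unfolding small_def by (intro exI[of _ y]) auto
qed

lemma small_lepoll: "small X \<Longrightarrow> Y \<lesssim> X \<Longrightarrow> small Y" for X Y :: "'a::zfc set"
  unfolding lepoll_iff using small_subset[OF small_image] by blast

lemma small_UN:
  fixes X :: "'a::zfc set" and F :: "'a \<Rightarrow> 'a set"
  assumes "small X" "\<And>i. i \<in> X \<Longrightarrow> small (F i)"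
  shows "small (\<Union>i\<in>X. F i)"
proof -
  obtain x where x: "elts x = (\<lambda>i. vset (F i)) ` X"
    using small_image[OF assms(1), of "\<lambda>i. vset (F i)"] unfolding small_def by metis
  obtain u where "elts u = (\<Union>y\<in>elts x. elts y)" using union[of x] by blast
  then have "elts u = (\<Union>i\<in>X. F i)" using x assms(2) by auto
  then show ?thesis by (auto simp: small_def)
qed

lemma small_doubleton: "small {x, y}"
  unfolding small_def by (rule pairing)

lemma small_Un: "small X \<Longrightarrow> small Y \<Longrightarrow> small (X \<union> Y)"
proof -
  assume s: "small X" "small Y"
  have "small (\<Union>z\<in>{vset X, vset Y}. elts z)"
    by (rule small_UN) (auto simp: small_doubleton)
  then show ?thesis using s by simp
qed

lemma small_insert: "small X \<Longrightarrow> small (insert x X)"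
  using small_Un[of "{x}" X] small_doubleton[of x x] by simp

lemma small_Pow: "small {y. elts y \<subseteq> elts x}"
  unfolding small_def by (rule power_set)

lemma mem_irrefl: "x \<notin> elts x"
  using foundation[of "vset {x}"] small_doubleton[of x x] by auto

text \<open>The axiom of infinity is linked to the type \<open>nat\<close> by counting elements: its
  witness contains finite sets of every size, so replacement along \<open>f (card (elts x))\<close>
  covers the range of \<open>f\<close>.\<close>

lemma small_range_nat: "small (range (f :: nat \<Rightarrow> 'a::zfc))"
proof -
  obtain w :: 'a where e: "\<exists>e\<in>elts w. elts e = {}"
    and s: "\<forall>x\<in>elts w. \<exists>s\<in>elts w. elts s = insert x (elts x)"
    using infinity[where 'a='a] by (elim exE conjE)
  have *: "\<exists>x\<in>elts w. finite (elts x) \<and> card (elts x) = n" for n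
  proof (induction n)
    case 0
    from e obtain x where "x \<in> elts w" "elts x = {}" by blast
    then show ?case by (intro bexI[of _ x]) simp_all
  next
    case (Suc n)
    then obtain x where x: "x \<in> elts w" "finite (elts x)" "card (elts x) = n" by auto
    from bspec[OF s x(1)] obtain y where y: "y \<in> elts w" "elts y = insert x (elts x)" by (elim bexE)
    then have "finite (elts y) \<and> card (elts y) = Suc n" using x(2,3) mem_irrefl[of x] by simp
    with y(1) show ?case by (rule bexI[rotated])
  qed
  have "range f \<subseteq> (\<lambda>x. f (card (elts x))) ` elts w"
  proof
    fix y assume "y \<in> range f"
    then obtain n where "y = f n" by auto
    moreover obtain x where "x \<in> elts w" "card (elts x) = n" using * by blast
    ultimately show "y \<in> (\<lambda>x. f (card (elts x))) ` elts w" by blast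
  qed
  then show ?thesis by (rule small_subset[OF small_image[OF small_elts]])
qed

lemma exists_transitive_superset:
  assumes "small X"
  shows "\<exists>T. small T \<and> transitive_class T \<and> X \<subseteq> T"
proof -
  define F where "F n = ((\<lambda>Y. \<Union>y\<in>Y. elts y) ^^ n) X" for n
  have F0: "F 0 = X" and FS: "F (Suc n) = (\<Union>y\<in>F n. elts y)" for n
    by (simp_all add: F_def)
  have F: "small (F n)" for n
  proof (induction n)
    case (Suc n)
    then show ?case unfolding FS by (rule small_UN) (rule small_elts)
  qed (simp add: F0 assms)
  have "small (\<Union>z\<in>range (\<lambda>n. vset (F n)). elts z)"
    by (rule small_UN[OF small_range_nat small_elts])
  then have "small (\<Union>n. F n)" using F by simp
  moreover have "transitive_class (\<Union>n. F n)"
    unfolding transitive_class_def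
  proof (intro ballI subsetI)
    fix x y assume "x \<in> (\<Union>n. F n)" "y \<in> elts x"
    then obtain n where "x \<in> F n" by auto
    with \<open>y \<in> elts x\<close> have "y \<in> F (Suc n)" by (auto simp: FS)
    then show "y \<in> (\<Union>n. F n)" by blast
  qed
  moreover have "X \<subseteq> (\<Union>n. F n)" using F0 by blast
  ultimately show ?thesis by (intro exI[of _ "\<Union>n. F n"] conjI)
qed

text \<open>Foundation speaks of sets, well-foundedness of arbitrary classes \<open>Q\<close>.
  Intersecting \<open>Q\<close> with a transitive set around one of its points leaves a set whose
  minimal elements are minimal in all of \<open>Q\<close>.\<close>

lemma wf_mem: "wf {(x, y). x \<in> elts (y::'a::zfc)}"
proof (rule wfI_min)
  fix x :: 'a and Q assume "x \<in> Q"
  obtain T where T: "small T" "transitive_class T" "{x} \<subseteq> T"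
    using exists_transitive_superset[OF small_doubleton[of x x]] by auto
  have sm: "small (T \<inter> Q)" by (rule small_subset[OF T(1)]) simp
  then have "elts (vset (T \<inter> Q)) \<noteq> {}" using T(3) \<open>x \<in> Q\<close> by auto
  from foundation[OF this] sm obtain z where "z \<in> T" "z \<in> Q" "elts z \<inter> (T \<inter> Q) = {}" by auto
  moreover have "elts z \<subseteq> T" using T(2) \<open>z \<in> T\<close> by (simp add: transitive_class_def)
  ultimately show "\<exists>z\<in>Q. \<forall>y. (y, z) \<in> {(x, y). x \<in> elts y} \<longrightarrow> y \<notin> Q"
    by (intro bexI[of _ z]) auto
qed

lemma mem_induct [case_names step]:
  assumes "\<And>x. (\<And>y. y \<in> elts x \<Longrightarrow> P y) \<Longrightarrow> P x"
  shows "P (x::'a::zfc)"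
  using wf_induct_rule[OF wf_mem, of P x] assms by auto

lemma mem_asym: "x \<in> elts y \<Longrightarrow> y \<notin> elts x"
  using wf_not_sym[OF wf_mem, of x y] by auto


section \<open>Ordinals\<close>

lemma Ord_mem: "Ord a \<Longrightarrow> b \<in> elts a \<Longrightarrow> Ord b"
  unfolding Ord_def transitive_class_def by blast

lemma Ord_trans: "Ord a \<Longrightarrow> b \<in> elts a \<Longrightarrow> c \<in> elts b \<Longrightarrow> c \<in> elts a"
  unfolding Ord_def transitive_class_def by blast

lemma Ord_elts_subset: "Ord a \<Longrightarrow> b \<in> elts a \<Longrightarrow> elts b \<subseteq> elts a"
  using Ord_trans by blast

lemma Ord_vset: "small X \<Longrightarrow> transitive_class X \<Longrightarrow> (\<And>x. x \<in> X \<Longrightarrow> Ord x) \<Longrightarrow> Ord (vset X)"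
  unfolding Ord_def by auto

lemma Ord_linear:
  assumes "Ord a" "Ord b"
  shows "a \<in> elts b \<or> a = b \<or> b \<in> elts a"
  using assms
proof (induction a arbitrary: b rule: mem_induct)
  case a: (step a)
  show ?case using \<open>Ord b\<close>
  proof (induction b rule: mem_induct)
    case b: (step b)
    show ?case
    proof (rule ccontr)
      assume n: "\<not> ?thesis"
      have "x \<in> elts b" if "x \<in> elts a" for x
        using a.IH[OF that Ord_mem[OF \<open>Ord a\<close> that] \<open>Ord b\<close>] n that Ord_trans[OF \<open>Ord a\<close> that] by auto
      moreover have "y \<in> elts a" if "y \<in> elts b" for y
        using b.IH[OF that Ord_mem[OF \<open>Ord b\<close> that]] n that Ord_trans[OF \<open>Ord b\<close> that] by auto
      ultimately have "a = b" by (intro extensionality) auto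
      with n show False by simp
    qed
  qed
qed

lemma Ord_not_mem_iff: "Ord a \<Longrightarrow> Ord b \<Longrightarrow> a \<notin> elts b \<longleftrightarrow> elts b \<subseteq> elts a"
  using Ord_linear[of a b] Ord_elts_subset[of a b] mem_irrefl[of a] by auto

lemma Ord_finite_max:
  assumes "finite X" "X \<noteq> {}" "\<And>x. x \<in> X \<Longrightarrow> Ord x"
  shows "\<exists>m\<in>X. \<forall>x\<in>X. elts x \<subseteq> elts m"
  using assms
proof (induction X rule: finite_ne_induct)
  case (insert x F)
  then obtain m where m: "m \<in> F" "\<forall>x\<in>F. elts x \<subseteq> elts m" by auto
  show ?case
  proof (cases "x \<in> elts m")
    case True
    then show ?thesis using m insert.prems by (intro bexI[of _ m]) (auto dest: Ord_elts_subset)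
  next
    case False
    then have "elts m \<subseteq> elts x" using Ord_not_mem_iff[of x m] m insert.prems by auto
    then show ?thesis using m by (intro bexI[of _ x]) auto
  qed
qed auto

lemma limit_Ord_infinite:
  assumes "limit_Ord a"
  shows "infinite (elts a)"
proof
  assume "finite (elts a)"
  moreover have a: "Ord a" "elts a \<noteq> {}" using assms by (auto simp: limit_Ord_def)
  ultimately obtain m where m: "m \<in> elts a" "\<forall>x\<in>elts a. elts x \<subseteq> elts m"
    using Ord_finite_max[of "elts a"] Ord_mem by blast
  then obtain b where "b \<in> elts a" "m \<in> elts b" using assms unfolding limit_Ord_def by blast
  with m have "m \<in> elts m" by blast
  then show False using mem_irrefl by blast
qed

abbreviation succ :: "'a::zfc \<Rightarrow> 'a" where
  "succ x \<equiv> vset (insert x (elts x))"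

lemma elts_succ [simp]: "elts (succ x) = insert x (elts x)"
  by (simp add: small_insert)

lemma Ord_succ: "Ord a \<Longrightarrow> Ord (succ a)"
  unfolding Ord_def transitive_class_def by auto

lemma Ord_not_limit_succ:
  assumes "Ord a" "elts a \<noteq> {}" "\<not> limit_Ord a"
  shows "\<exists>b\<in>elts a. a = succ b"
proof -
  obtain b where b: "b \<in> elts a" "\<And>c. c \<in> elts a \<Longrightarrow> b \<notin> elts c"
    using assms unfolding limit_Ord_def by blast
  have "elts a \<subseteq> insert b (elts b)"
    using b Ord_linear Ord_mem[OF assms(1)] by blast
  moreover have "insert b (elts b) \<subseteq> elts a" using b assms(1) Ord_trans by blast
  ultimately have "a = succ b" by (intro extensionality) auto
  with b show ?thesis by blast
qed

lemma limit_Ord_succ_mem: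
  assumes "limit_Ord a" "b \<in> elts a"
  shows "succ b \<in> elts a"
proof -
  obtain c where c: "c \<in> elts a" "b \<in> elts c" using assms unfolding limit_Ord_def by blast
  have "Ord a" using assms by (simp add: limit_Ord_def)
  then have "Ord c" "Ord b" using c assms Ord_mem by blast+
  have "a \<notin> elts (succ b)"
    using \<open>b \<in> elts a\<close> mem_asym[of b a] mem_irrefl[of a] by auto
  moreover have "a \<noteq> succ b" using c mem_asym[of b c] mem_irrefl[of b] by auto
  ultimately show ?thesis using Ord_linear[OF \<open>Ord a\<close> Ord_succ[OF \<open>Ord b\<close>]] by blast
qed

lemma Ord_Union:
  assumes "\<And>x. x \<in> X \<Longrightarrow> Ord x" "small X"
  shows "Ord (vset (\<Union>x\<in>X. elts x))"
  by (rule Ord_vset)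
    (use assms in \<open>auto intro: small_UN Ord_mem simp: transitive_class_def dest: Ord_trans\<close>)

lemma least_Ord:
  assumes "Ord a" "P a"
  shows "Ord (least_Ord P)" "P (least_Ord P)" "b \<in> elts (least_Ord P) \<Longrightarrow> \<not> P b"
    "elts (least_Ord P) \<subseteq> elts a"
proof -
  have "a \<in> {a. Ord a \<and> P a}" using assms by simp
  from wfE_min[OF wf_mem this]
  obtain m where m: "Ord m" "P m" "\<And>y. y \<in> elts m \<Longrightarrow> \<not> (Ord y \<and> P y)" by auto
  have "least_Ord P = m"
    unfolding least_Ord_def
  proof (rule the_equality)
    show "Ord m \<and> P m \<and> (\<forall>b\<in>elts m. \<not> P b)" using m Ord_mem by blast
    show "x = m" if "Ord x \<and> P x \<and> (\<forall>b\<in>elts x. \<not> P b)" for x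
      using Ord_linear[of x m] that m by blast
  qed
  moreover have "\<not> P b" if "b \<in> elts m"
    using m(3)[OF that] Ord_mem[OF m(1) that] by simp
  moreover have "elts m \<subseteq> elts a"
    using m(3)[of a] Ord_not_mem_iff[OF assms(1) m(1)] assms by auto
  ultimately show "Ord (least_Ord P)" "P (least_Ord P)" "b \<in> elts (least_Ord P) \<Longrightarrow> \<not> P b"
    "elts (least_Ord P) \<subseteq> elts a"
    using m(1,2) by auto
qed


section \<open>Mostowski collapse and cardinality\<close>

definition collapse :: "('a::zfc \<times> 'a) set \<Rightarrow> 'a \<Rightarrow> 'a" where
  "collapse r = wfrec r (\<lambda>f x. vset (f ` {y. (y, x) \<in> r}))"

text \<open>The relation is kept general because two collapses occur: the strict part of a
  well-order, which yields an ordinal, and membership on a Skolem hull, which yields the transitive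
  model M.\<close>

locale collapsible =
  fixes r :: "('a::zfc \<times> 'a) set" and X :: "'a set"
  assumes wf: "wf r"
    and small_X: "small X"
    and r_X: "r \<subseteq> X \<times> X"
    and ext: "x \<in> X \<Longrightarrow> y \<in> X \<Longrightarrow> (\<And>z. (z, x) \<in> r \<longleftrightarrow> (z, y) \<in> r) \<Longrightarrow> x = y"
begin

lemma elts_collapse: "elts (collapse r x) = collapse r ` {y. (y, x) \<in> r}"
proof -
  have "collapse r x = vset (cut (collapse r) r x ` {y. (y, x) \<in> r})"
    unfolding collapse_def by (subst wfrec[OF wf]) simp
  also have "cut (collapse r) r x ` {y. (y, x) \<in> r} = collapse r ` {y. (y, x) \<in> r}"
    by (intro image_cong) (auto simp: cut_def)
  finally have "collapse r x = vset (collapse r ` {y. (y, x) \<in> r})" .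
  moreover have "small {y. (y, x) \<in> r}" by (rule small_subset[OF small_X]) (use r_X in auto)
  ultimately show ?thesis by (simp add: small_image)
qed

lemma collapse_inj:
  assumes "x \<in> X" "y \<in> X" "collapse r x = collapse r y"
  shows "x = y"
  using assms
proof (induction x arbitrary: y rule: wf_induct_rule[OF wf])
  case (1 x)
  show ?case
  proof (rule ext[OF 1(2,3)], rule iffI)
    fix z assume z: "(z, x) \<in> r"
    then have "collapse r z \<in> elts (collapse r y)" using 1(4) elts_collapse[of x] by auto
    then obtain w where "(w, y) \<in> r" "collapse r z = collapse r w"
      unfolding elts_collapse by auto
    with 1(1)[OF z, of w] r_X z show "(z, y) \<in> r" by auto
  next
    fix z assume z: "(z, y) \<in> r"
    then have "collapse r z \<in> elts (collapse r x)" using 1(4) elts_collapse[of y] by auto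
    then obtain w where w: "(w, x) \<in> r" "collapse r w = collapse r z"
      unfolding elts_collapse by auto
    with 1(1)[OF w(1), of z] r_X z show "(z, x) \<in> r" by auto
  qed
qed

lemma inj_on_collapse: "inj_on (collapse r) X"
  using collapse_inj by (auto intro: inj_onI)

lemma collapse_mem_iff: "x \<in> X \<Longrightarrow> y \<in> X \<Longrightarrow> collapse r x \<in> elts (collapse r y) \<longleftrightarrow> (x, y) \<in> r"
  unfolding elts_collapse using collapse_inj[of x] r_X by auto

lemma transitive_collapse: "transitive_class (collapse r ` X)"
  unfolding transitive_class_def using elts_collapse r_X by auto

end

lemma small_eqpoll_Ord:
  assumes "small (X :: 'a::zfc set)"
  shows "\<exists>a::'a. Ord a \<and> elts a \<approx> X"
proof -
  obtain r where r: "well_order_on X r" using well_order_on by blast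
  have tot: "total_on X r" and anti: "antisym r" and tr: "trans r" and fld: "r \<subseteq> X \<times> X"
    using r by (auto simp: well_order_on_def linear_order_on_def partial_order_on_def preorder_on_def refl_on_def)
  interpret collapsible "r - Id" X
  proof
    show "wf (r - Id)" using r by (simp add: well_order_on_def)
    show "x = y" if "x \<in> X" "y \<in> X" "\<And>z. (z, x) \<in> r - Id \<longleftrightarrow> (z, y) \<in> r - Id" for x y
      using that tot unfolding total_on_def by blast
  qed (use assms fld in auto)
  let ?c = "collapse (r - Id)"
  have sm: "small (?c ` X)" using assms by (rule small_image)
  have "transitive_class (elts (?c x))" if "x \<in> X" for x
    unfolding transitive_class_def
  proof (intro ballI subsetI)
    fix u v assume "u \<in> elts (?c x)" "v \<in> elts u"
    then obtain y z where yz: "(y, x) \<in> r - Id" "u = ?c y" "(z, y) \<in> r - Id" "v = ?c z"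
      by (auto simp: elts_collapse)
    then have "(z, x) \<in> r - Id" using tr anti unfolding trans_def antisym_def by blast
    with yz show "v \<in> elts (?c x)" by (auto simp: elts_collapse)
  qed
  then have "Ord (vset (?c ` X))"
    unfolding Ord_def using transitive_collapse sm by auto
  moreover have "elts (vset (?c ` X)) \<approx> X" using sm inj_on_collapse by simp
  ultimately show ?thesis by blast
qed

lemma small_eqpoll_Card:
  assumes "small (X :: 'a::zfc set)"
  shows "\<exists>c::'a. Card c \<and> elts c \<approx> X"
proof -
  obtain a :: 'a where "Ord a" "elts a \<approx> X" using small_eqpoll_Ord[OF assms] by blast
  note l = least_Ord[of a "\<lambda>c::'a. elts c \<approx> X", OF this]
  let ?c = "least_Ord (\<lambda>c::'a. elts c \<approx> X)"
  have "\<not> elts b \<approx> elts ?c" if "b \<in> elts ?c" for b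
    using l(3)[OF that] eqpoll_trans[OF _ l(2)] by blast
  with l(1) have "Card ?c" by (simp add: Card_def)
  with l(2) show ?thesis by blast
qed

lemma Card_Ord: "Card k \<Longrightarrow> Ord k"
  by (simp add: Card_def)

lemma Card_mem_lesspoll:
  assumes "Card k" "a \<in> elts k"
  shows "elts a \<prec> elts k"
  using assms Ord_elts_subset[of k a] subset_imp_lepoll unfolding Card_def lesspoll_def by blast

lemma Ord_lesspoll_mem:
  assumes "Ord k" "Ord a" "elts a \<prec> elts k"
  shows "a \<in> elts k"
proof (rule ccontr)
  assume "a \<notin> elts k"
  then have "elts k \<subseteq> elts a" using Ord_not_mem_iff assms by blast
  then show False using assms(3) subset_imp_lepoll lesspoll_trans2 by blast
qed

lemma subset_lesspoll: "A \<subseteq> B \<Longrightarrow> B \<prec> C \<Longrightarrow> A \<prec> C"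
  by (rule lesspoll_trans1[OF subset_imp_lepoll])

lemma subsets_eqpoll_Pow: "{z::'a::zfc. elts z \<subseteq> elts y} \<approx> Pow (elts y)"
proof -
  have "inj_on elts {z. elts z \<subseteq> elts y}" by (auto intro: inj_onI extensionality)
  moreover have "elts ` {z. elts z \<subseteq> elts y} = Pow (elts y)"
    using small_subset[OF small_elts[of y]] by (auto simp: image_iff) (metis elts_vset)
  ultimately show ?thesis by (metis inj_on_image_eqpoll_self eqpoll_sym)
qed

text \<open>Cantor's theorem for the union of \<open>X\<close> and \<open>a\<close>: the cardinality
  of its power set exceeds both.\<close>

lemma exists_large_Card:
  assumes "Ord a" "small (X :: 'a::zfc set)"
  shows "\<exists>t::'a. Card t \<and> a \<in> elts t \<and> X \<prec> elts t"
proof -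
  define y where "y = vset (X \<union> elts a)"
  have y: "elts y = X \<union> elts a" unfolding y_def by (simp add: assms small_Un)
  obtain t :: 'a where t: "Card t" "elts t \<approx> {z. elts z \<subseteq> elts y}"
    using small_eqpoll_Card[OF small_Pow] by blast
  have "Pow (elts y) \<approx> elts t" using eqpoll_sym[OF eqpoll_trans[OF t(2) subsets_eqpoll_Pow]] .
  then have "elts y \<prec> elts t" using lesspoll_Pow_self lesspoll_eq_trans by blast
  then have "X \<prec> elts t" "elts a \<prec> elts t"
    unfolding y by (auto elim: subset_lesspoll[rotated])
  then show ?thesis using t(1) Ord_lesspoll_mem Card_Ord assms(1) by blast
qed

lemma infinite_Card_limit:
  assumes "Card k" "infinite (elts k)"
  shows "limit_Ord k"
proof (rule ccontr)
  assume "\<not> limit_Ord k"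
  then obtain b where b: "b \<in> elts k" "k = succ b"
    using Ord_not_limit_succ[of k] Card_Ord[OF assms(1)] assms(2) by fastforce
  then have "elts k = insert b (elts b)" by (metis elts_succ)
  then have "elts k \<approx> elts b" using assms(2) infinite_insert_eqpoll[of "elts b" b] by auto
  then show False using Card_mem_lesspoll[OF assms(1) b(1)] eqpoll_sym lesspoll_def by blast
qed

lemma Card_uncountable:
  assumes "Card k" "a \<in> elts k" "infinite (elts a)"
  shows "uncountable (elts k)"
proof
  assume c: "countable (elts k)"
  have "elts a \<prec> elts k" by (rule Card_mem_lesspoll) fact+
  moreover have "elts k \<lesssim> elts a"
    using c assms(3) infinite_le_lepoll lepoll_trans countable_lepoll
    by (metis countableE lepoll_def subset_UNIV)
  ultimately show False using lesspoll_trans2 by blast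
qed

text \<open>Together with \<open>Card_uncountable\<close> this makes uncountability of a cardinal
  equivalent to having a limit ordinal below it, which a bounded formula can express. The limit
  found is the cardinality of a countably infinite set.\<close>

lemma uncountable_Card_mem_limit:
  assumes "Card (k::'a::zfc)" "uncountable (elts k)"
  shows "\<exists>a\<in>elts k. limit_Ord a"
proof -
  have "infinite (elts k)" using assms(2) countable_finite by blast
  then obtain f :: "nat \<Rightarrow> 'a" where f: "inj f"
    using infinite_countable_subset by blast
  obtain w :: 'a where w: "Card w" "elts w \<approx> range f"
    using small_eqpoll_Card[OF small_range_nat] by blast
  have inf: "infinite (elts w)"
    using eqpoll_finite_iff[OF w(2)] range_inj_infinite[OF f] by simp
  have "countable (elts w)" by (rule countable_eqpoll[OF _ w(2)]) simp
  then have "\<not> elts k \<subseteq> elts w" using assms(2) countable_subset by blast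
  then have "w \<in> elts k" using Ord_not_mem_iff[of w k] assms w Card_Ord by blast
  then show ?thesis using infinite_Card_limit[OF w(1) inf] by blast
qed


section \<open>Regular cardinals\<close>

lemma cofinality_le:
  assumes "Ord a" "f ` elts a \<subseteq> elts k" "\<forall>b\<in>elts k. \<exists>x\<in>elts a. ord_le b (f x)"
  shows "elts (cofinality k) \<subseteq> elts a"
  unfolding cofinality_def by (rule least_Ord(4)) (use assms in auto)

lemma regular_cardinal_bounded:
  assumes "regular_cardinal k" "Y \<subseteq> elts k" "Y \<prec> elts k"
  shows "\<exists>d\<in>elts k. \<forall>y\<in>Y. y \<in> elts d"
proof (rule ccontr)
  assume n: "\<not> ?thesis"
  have k: "Card k" "Ord k" "cofinality k = k" using assms(1) by (auto simp: regular_cardinal_def Card_Ord)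
  have "small Y" by (rule small_subset[OF small_elts]) fact
  then obtain a :: 'a where a: "Ord a" "elts a \<approx> Y" using small_eqpoll_Ord by blast
  then obtain f where f: "bij_betw f (elts a) Y" by (auto simp: eqpoll_def)
  have "elts (cofinality k) \<subseteq> elts a"
  proof (rule cofinality_le[OF a(1), of f])
    show "f ` elts a \<subseteq> elts k" using f assms(2) by (auto simp: bij_betw_def)
    show "\<forall>b\<in>elts k. \<exists>x\<in>elts a. ord_le b (f x)"
    proof
      fix b assume b: "b \<in> elts k"
      with n obtain y where y: "y \<in> Y" "y \<notin> elts b" by blast
      then have "ord_le b y"
        using Ord_linear[of b y] Ord_mem[OF k(2)] b assms(2) by (auto simp: ord_le_def)
      moreover obtain x where "x \<in> elts a" "f x = y" using f y by (auto simp: bij_betw_def)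
      ultimately show "\<exists>x\<in>elts a. ord_le b (f x)" by blast
    qed
  qed
  then have "elts k \<lesssim> elts a" using k subset_imp_lepoll by simp
  then show False using lepoll_trans2[OF _ a(2)] lesspoll_trans1[OF _ assms(3)] by blast
qed

lemma regular_cardinal_no_cofinal:
  assumes "regular_cardinal k" "d \<in> elts k" "f ` elts d \<subseteq> elts k"
  shows "\<exists>b\<in>elts k. \<forall>x\<in>elts d. f x \<in> elts b"
proof -
  have "f ` elts d \<prec> elts k"
    by (rule lesspoll_trans1[OF image_lepoll Card_mem_lesspoll])
      (use assms in \<open>auto simp: regular_cardinal_def\<close>)
  from regular_cardinal_bounded[OF assms(1,3) this] show ?thesis by auto
qed

text \<open>Regularity of a limit ordinal fails in two ways. Either the cofinality is smaller, or
  \<open>k\<close> is not a cardinal, and then a bijection from a smaller ordinal is already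
  cofinal. Applying cofinality to successors turns \<open>ord_le\<close> into strict
  membership.\<close>

lemma singular_cofinal_map:
  assumes "limit_Ord k" "\<not> regular_cardinal k"
  shows "\<exists>d\<in>elts k. \<exists>f. f ` elts d \<subseteq> elts k \<and> (\<forall>b\<in>elts k. \<exists>x\<in>elts d. b \<in> elts (f x))"
proof -
  let ?P = "\<lambda>a. \<exists>f. f ` elts a \<subseteq> elts k \<and> (\<forall>b\<in>elts k. \<exists>x\<in>elts a. ord_le b (f x))"
  have k: "Ord k" using assms by (simp add: limit_Ord_def)
  have "?P k" by (intro exI[of _ id]) (auto simp: ord_le_def)
  note l = least_Ord[of k ?P, OF k this, folded cofinality_def]
  have "\<exists>d\<in>elts k. ?P d"
  proof (cases "cofinality k = k")
    case False
    then have "cofinality k \<in> elts k" using l(4) Ord_not_mem_iff[OF l(1) k] extensionality by blast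
    with l(2) show ?thesis by blast
  next
    case True
    then have "\<not> Card k" using assms limit_Ord_infinite by (auto simp: regular_cardinal_def)
    then obtain d where d: "d \<in> elts k" "elts d \<approx> elts k" using k by (auto simp: Card_def)
    then obtain f where "bij_betw f (elts d) (elts k)" by (auto simp: eqpoll_def)
    then have "?P d" by (intro exI[of _ f]) (auto simp: bij_betw_def ord_le_def)
    with d show ?thesis by blast
  qed
  then obtain d f where d: "d \<in> elts k" "f ` elts d \<subseteq> elts k" "\<forall>b\<in>elts k. \<exists>x\<in>elts d. ord_le b (f x)"
    by blast
  have "\<forall>b\<in>elts k. \<exists>x\<in>elts d. b \<in> elts (f x)"
  proof
    fix b assume "b \<in> elts k"
    then have "succ b \<in> elts k" using assms limit_Ord_succ_mem by blast
    with d(3) obtain x where x: "x \<in> elts d" "ord_le (succ b) (f x)" by blast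
    moreover have "Ord (f x)" using d x k Ord_mem by blast
    ultimately have "b \<in> elts (f x)"
      using Ord_trans[of "f x" "succ b" b] unfolding ord_le_def by (metis elts_succ insertI1)
    with x show "\<exists>x\<in>elts d. b \<in> elts (f x)" by blast
  qed
  with d show ?thesis by blast
qed


section \<open>Formulas and the sets \<open>H(\<theta>)\<close>\<close>

lemma H_I:
  assumes "small T" "transitive_class T" "elts x \<subseteq> T" "T \<prec> elts t"
  shows "x \<in> H t"
proof -
  have "transitive_closure x \<subseteq> elts (vset T)"
    unfolding transitive_closure_def by (rule Inter_lower) (use assms in \<open>auto intro!: exI[of _ "vset T"]\<close>)
  then have "transitive_closure x \<subseteq> T" using assms(1) by simp
  from subset_lesspoll[OF this assms(4)] show ?thesis by (simp add: H_def)
qed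

lemma transitive_H: "transitive_class (H t)"
  unfolding transitive_class_def
proof (intro ballI subsetI)
  fix x y assume "x \<in> H t" "y \<in> elts x"
  have "transitive_closure y \<subseteq> transitive_closure x"
    unfolding transitive_closure_def
  proof (rule Inter_anti_mono, rule subsetI)
    fix s assume "s \<in> {elts t |t. transitive_class (elts t) \<and> elts x \<subseteq> elts t}"
    with \<open>y \<in> elts x\<close> show "s \<in> {elts t |t. transitive_class (elts t) \<and> elts y \<subseteq> elts t}"
      unfolding transitive_class_def by blast
  qed
  with \<open>x \<in> H t\<close> show "y \<in> H t" unfolding H_def using subset_lesspoll by blast
qed

definition Disj :: "fm \<Rightarrow> fm \<Rightarrow> fm" where
  "Disj \<phi> \<psi> = Neg (Conj (Neg \<phi>) (Neg \<psi>))"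

definition BEx :: "nat \<Rightarrow> nat \<Rightarrow> fm \<Rightarrow> fm" where
  "BEx n m \<phi> = Exists n (Conj (Mem n m) \<phi>)"

definition BAll :: "nat \<Rightarrow> nat \<Rightarrow> fm \<Rightarrow> fm" where
  "BAll n m \<phi> = Neg (BEx n m (Neg \<phi>))"

lemma sat_Disj [simp]: "sat A (Disj \<phi> \<psi>) e \<longleftrightarrow> sat A \<phi> e \<or> sat A \<psi> e"
  by (simp add: Disj_def)

inductive delta0 :: "fm \<Rightarrow> bool" where
  Mem: "delta0 (Mem m n)"
| Equal: "delta0 (Equal m n)"
| Neg: "delta0 \<phi> \<Longrightarrow> delta0 (Neg \<phi>)"
| Conj: "delta0 \<phi> \<Longrightarrow> delta0 \<psi> \<Longrightarrow> delta0 (Conj \<phi> \<psi>)"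
| BEx: "delta0 \<phi> \<Longrightarrow> m \<noteq> n \<Longrightarrow> delta0 (BEx n m \<phi>)"

lemma delta0_Disj: "delta0 \<phi> \<Longrightarrow> delta0 \<psi> \<Longrightarrow> delta0 (Disj \<phi> \<psi>)"
  unfolding Disj_def by (intro delta0.intros)

lemma delta0_BAll: "delta0 \<phi> \<Longrightarrow> m \<noteq> n \<Longrightarrow> delta0 (BAll n m \<phi>)"
  unfolding BAll_def by (intro delta0.intros)

lemmas delta0_intros = delta0.intros delta0_Disj delta0_BAll

lemma sat_BEx:
  "m \<noteq> n \<Longrightarrow> transitive_class A \<Longrightarrow> e m \<in> A \<Longrightarrow>
    sat A (BEx n m \<phi>) e \<longleftrightarrow> (\<exists>x\<in>elts (e m). sat A \<phi> (e(n := x)))"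
  unfolding BEx_def transitive_class_def by auto

lemma sat_BAll:
  "m \<noteq> n \<Longrightarrow> transitive_class A \<Longrightarrow> e m \<in> A \<Longrightarrow>
    sat A (BAll n m \<phi>) e \<longleftrightarrow> (\<forall>x\<in>elts (e m). sat A \<phi> (e(n := x)))"
  unfolding BAll_def by (simp add: sat_BEx)

lemma sat_UNIV_BEx [simp]:
  "m \<noteq> n \<Longrightarrow> sat UNIV (BEx n m \<phi>) e \<longleftrightarrow> (\<exists>x\<in>elts (e m). sat UNIV \<phi> (e(n := x)))"
  by (rule sat_BEx) (auto simp: transitive_class_def)

lemma sat_UNIV_BAll [simp]:
  "m \<noteq> n \<Longrightarrow> sat UNIV (BAll n m \<phi>) e \<longleftrightarrow> (\<forall>x\<in>elts (e m). sat UNIV \<phi> (e(n := x)))"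
  by (rule sat_BAll) (auto simp: transitive_class_def)

text \<open>Evaluation in \<open>UNIV\<close> gives a formula its literal meaning, so this is the
  bridge by which M and H(\<theta>) are both compared with V.\<close>

lemma delta0_absolute:
  assumes "delta0 \<phi>" "transitive_class A" "range e \<subseteq> A"
  shows "sat A \<phi> e \<longleftrightarrow> sat UNIV \<phi> e"
  using assms(1,3)
proof (induction arbitrary: e)
  case (BEx \<phi> m n)
  have "sat A \<phi> (e(n := x)) \<longleftrightarrow> sat UNIV \<phi> (e(n := x))" if "x \<in> elts (e m)" for x
  proof (rule BEx.IH)
    have "x \<in> A" using that BEx.prems assms(2) by (auto simp: transitive_class_def)
    then show "range (e(n := x)) \<subseteq> A" using BEx.prems by auto
  qed
  moreover have "e m \<in> A" using BEx.prems by auto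
  ultimately show ?case using BEx.hyps(2) assms(2) by (simp add: sat_BEx)
qed auto

text \<open>A bound on the free variables lets an assignment be cut down to a finite list of
  parameters. Skolem functions can then take lists as arguments, and since there are countably many
  formulas, hulls stay small.\<close>

primrec vbound :: "fm \<Rightarrow> nat" where
  "vbound (Mem m n) = Suc (max m n)"
| "vbound (Equal m n) = Suc (max m n)"
| "vbound (Neg \<phi>) = vbound \<phi>"
| "vbound (Conj \<phi> \<psi>) = max (vbound \<phi>) (vbound \<psi>)"
| "vbound (Exists n \<phi>) = vbound \<phi>"

lemma sat_cong: "(\<And>i. i < vbound \<phi> \<Longrightarrow> e i = e' i) \<Longrightarrow> sat A \<phi> e \<longleftrightarrow> sat A \<phi> e'"
proof (induction \<phi> arbitrary: e e')
  case (Neg \<phi>)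
  from Neg.IH[of e e'] Neg.prems show ?case by simp
next
  case (Conj \<phi> \<psi>)
  from Conj.IH(1)[of e e'] Conj.IH(2)[of e e'] Conj.prems show ?case by simp
next
  case (Exists n \<phi>)
  have "sat A \<phi> (e(n := x)) \<longleftrightarrow> sat A \<phi> (e'(n := x))" for x
    by (rule Exists.IH) (use Exists.prems in auto)
  then show ?case by simp
qed auto

instance fm :: countable
  by countable_datatype

lemma sat_isomorphism:
  assumes "inj_on \<pi> X" "\<And>x y. x \<in> X \<Longrightarrow> y \<in> X \<Longrightarrow> \<pi> x \<in> elts (\<pi> y) \<longleftrightarrow> x \<in> elts y"
    "range e \<subseteq> X"
  shows "sat (\<pi> ` X) \<phi> (\<pi> \<circ> e) \<longleftrightarrow> sat X \<phi> e"
  using assms(3)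
proof (induction \<phi> arbitrary: e)
  case (Mem m n)
  then show ?case using assms(2)[of "e m" "e n"] by auto
next
  case (Equal m n)
  then show ?case using inj_onD[OF assms(1), of "e m" "e n"] by auto
next
  case (Exists n \<phi>)
  have "sat (\<pi> ` X) \<phi> ((\<pi> \<circ> e)(n := \<pi> x)) \<longleftrightarrow> sat X \<phi> (e(n := x))" if "x \<in> X" for x
  proof -
    have "range (e(n := x)) \<subseteq> X" using Exists.prems that by auto
    from Exists.IH[OF this] show ?thesis by (simp only: fun_upd_comp)
  qed
  then show ?case by (simp add: o_def)
qed auto


section \<open>Cardinalities of unions and of sets of lists\<close>

lemma UN_lepoll_infinite:
  assumes "infinite Z" "I \<lesssim> Z" "\<And>i. i \<in> I \<Longrightarrow> F i \<lesssim> Z"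
  shows "(\<Union>i\<in>I. F i) \<lesssim> Z"
  using card_of_UNION_ordLeq_infinite[of Z I F] assms unfolding lepoll_def card_of_ordLeq by blast

lemma Un_lepoll_infinite:
  assumes "infinite Z" "A \<lesssim> Z" "B \<lesssim> Z"
  shows "A \<union> B \<lesssim> Z"
proof -
  have "(\<Union>i\<in>{True, False}. if i then A else B) \<lesssim> Z"
    by (rule UN_lepoll_infinite) (use assms in \<open>auto intro: finite_lepoll_infinite\<close>)
  then show ?thesis by (simp add: Un_commute)
qed

lemma Times_lepoll_infinite:
  assumes "infinite Z" "A \<lesssim> Z" "B \<lesssim> Z"
  shows "A \<times> B \<lesssim> Z"
proof -
  have "{a} \<times> B \<lesssim> Z" for a :: 'b
    by (rule lepoll_trans1[OF times_singleton_eqpoll assms(3)])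
  then have "(\<Union>a\<in>A. {a} \<times> B) \<lesssim> Z" by (intro UN_lepoll_infinite assms)
  moreover have "(\<Union>a\<in>A. {a} \<times> B) = A \<times> B" by auto
  ultimately show ?thesis by simp
qed

lemma countable_lepoll_infinite:
  assumes "infinite Z" "countable A"
  shows "A \<lesssim> Z"
proof -
  have "A \<lesssim> (UNIV :: nat set)" using assms(2) by (auto simp: countable_def lepoll_def)
  also have "\<dots> \<lesssim> Z" using assms(1) infinite_le_lepoll by blast
  finally show ?thesis .
qed

lemma lists_lepoll_infinite:
  assumes "infinite Z" "A \<lesssim> Z"
  shows "lists A \<lesssim> Z"
proof -
  have len: "{xs \<in> lists A. length xs = n} \<lesssim> Z" for n
  proof (induction n)
    case 0
    have "{xs \<in> lists A. length xs = 0} \<subseteq> {[]}" by auto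
    then show ?case using assms(1) finite_lepoll_infinite finite_subset by blast
  next
    case (Suc n)
    have "{xs \<in> lists A. length xs = Suc n} \<subseteq>
        (\<lambda>(x, xs). x # xs) ` (A \<times> {xs \<in> lists A. length xs = n})"
      by (auto simp: length_Suc_conv image_iff)
    then have "{xs \<in> lists A. length xs = Suc n} \<lesssim> A \<times> {xs \<in> lists A. length xs = n}"
      by (rule subset_image_lepoll)
    also have "\<dots> \<lesssim> Z" by (intro Times_lepoll_infinite assms Suc)
    finally show ?case .
  qed
  have "(\<Union>n. {xs \<in> lists A. length xs = n}) \<lesssim> Z"
    by (intro UN_lepoll_infinite countable_lepoll_infinite assms(1) len) simp
  moreover have "(\<Union>n. {xs \<in> lists A. length xs = n}) = lists A" by auto
  ultimately show ?thesis by simp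
qed


section \<open>Skolem hulls\<close>

definition list_env :: "'a \<Rightarrow> 'a list \<Rightarrow> nat \<Rightarrow> 'a" where
  "list_env d xs i = (if i < length xs then xs ! i else d)"

text \<open>The default \<open>d\<close> stands in for missing parameters and for missing witnesses.
  Choosing \<open>d\<close> to be \<kappa> later puts \<kappa> into every hull without listing it
  among the generators.\<close>

definition skolem :: "'a::zfc set \<Rightarrow> 'a \<Rightarrow> fm \<Rightarrow> nat \<Rightarrow> 'a list \<Rightarrow> 'a" where
  "skolem B d \<phi> n xs =
    (if \<exists>x\<in>B. sat B \<phi> ((list_env d xs)(n := x))
     then SOME x. x \<in> B \<and> sat B \<phi> ((list_env d xs)(n := x)) else d)"

lemma skolem_in: "d \<in> B \<Longrightarrow> skolem B d \<phi> n xs \<in> B"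
  unfolding skolem_def by (auto intro: someI2_bex)

lemma sat_skolem:
  assumes "x \<in> B" "sat B \<phi> ((list_env d xs)(n := x))"
  shows "sat B \<phi> ((list_env d xs)(n := skolem B d \<phi> n xs))"
proof -
  from assms have "\<exists>x. x \<in> B \<and> sat B \<phi> ((list_env d xs)(n := x))" by blast
  from someI_ex[OF this] assms show ?thesis unfolding skolem_def by auto
qed

definition skolem_closed :: "'a::zfc set \<Rightarrow> 'a \<Rightarrow> 'a set \<Rightarrow> bool" where
  "skolem_closed B d X \<longleftrightarrow> X \<subseteq> B \<and> d \<in> X \<and> (\<forall>\<phi> n xs. set xs \<subseteq> X \<longrightarrow> skolem B d \<phi> n xs \<in> X)"

text \<open>The Tarski-Vaught criterion: a witness in \<open>B\<close> can be replaced by the value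
  of a Skolem function at parameters from \<open>X\<close>.\<close>

lemma skolem_closed_elementary:
  assumes "skolem_closed B d X" "range e \<subseteq> X"
  shows "sat X \<phi> e \<longleftrightarrow> sat B \<phi> e"
  using assms(2)
proof (induction \<phi> arbitrary: e)
  case (Exists n \<phi>)
  have X: "X \<subseteq> B" using assms(1) by (simp add: skolem_closed_def)
  have IH: "sat X \<phi> (e(n := x)) \<longleftrightarrow> sat B \<phi> (e(n := x))" if "x \<in> X" for x
    by (rule Exists.IH) (use Exists.prems that in auto)
  have "\<exists>x\<in>X. sat B \<phi> (e(n := x))" if ex: "x \<in> B" "sat B \<phi> (e(n := x))" for x
  proof -
    define xs where "xs = map e [0..<vbound \<phi>]"
    have env: "sat B \<phi> (e(n := y)) \<longleftrightarrow> sat B \<phi> ((list_env d xs)(n := y))" for y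
      by (rule sat_cong) (auto simp: list_env_def xs_def)
    have "set xs \<subseteq> X" using Exists.prems by (auto simp: xs_def)
    then have "skolem B d \<phi> n xs \<in> X" using assms(1) by (simp add: skolem_closed_def)
    with ex sat_skolem[of x B \<phi> d xs n] show ?thesis unfolding env by blast
  qed
  then show ?case using IH X by auto
qed auto

text \<open>A Skolem function has finitely many arguments, and finitely many elements of the union
  of a chain lie in a single member.\<close>

lemma skolem_closed_chain_UN:
  assumes "I \<noteq> {}" "\<And>i. i \<in> I \<Longrightarrow> skolem_closed B d (F i)"
    "\<And>i j. i \<in> I \<Longrightarrow> j \<in> I \<Longrightarrow> F i \<subseteq> F j \<or> F j \<subseteq> F i"
  shows "skolem_closed B d (\<Union>i\<in>I. F i)"
  unfolding skolem_closed_def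
proof (intro conjI allI impI)
  fix \<phi> n xs assume "set xs \<subseteq> (\<Union>i\<in>I. F i)"
  then have "\<exists>i\<in>I. set xs \<subseteq> F i"
  proof (induction xs)
    case Nil
    then show ?case using assms(1) by auto
  next
    case (Cons x xs)
    then obtain i j where "i \<in> I" "set xs \<subseteq> F i" "j \<in> I" "x \<in> F j" by auto
    with assms(3)[of i j] show ?case by auto
  qed
  with assms(2) show "skolem B d \<phi> n xs \<in> (\<Union>i\<in>I. F i)" unfolding skolem_closed_def by blast
next
  show "(\<Union>i\<in>I. F i) \<subseteq> B" "d \<in> (\<Union>i\<in>I. F i)"
    using assms(1,2) unfolding skolem_closed_def by blast+
qed

definition skolem_hull :: "'a::zfc set \<Rightarrow> 'a \<Rightarrow> 'a set \<Rightarrow> 'a set" where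
  "skolem_hull B d A = \<Inter>{X. skolem_closed B d X \<and> A \<subseteq> X}"

lemma skolem_hull_superset: "A \<subseteq> skolem_hull B d A"
  by (auto simp: skolem_hull_def)

lemma skolem_hull_mono: "A \<subseteq> A' \<Longrightarrow> skolem_hull B d A \<subseteq> skolem_hull B d A'"
  by (auto simp: skolem_hull_def)

lemma skolem_closed_hull:
  assumes "d \<in> B" "A \<subseteq> B"
  shows "skolem_closed B d (skolem_hull B d A)"
proof -
  have "skolem_closed B d B" using assms(1) by (auto simp: skolem_closed_def skolem_in)
  then have "skolem_hull B d A \<subseteq> B" using assms(2) by (auto simp: skolem_hull_def)
  then show ?thesis
    unfolding skolem_closed_def
  proof (intro conjI allI impI)
    fix \<phi> n xs assume xs: "set xs \<subseteq> skolem_hull B d A"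
    show "skolem B d \<phi> n xs \<in> skolem_hull B d A"
      unfolding skolem_hull_def
    proof (rule InterI)
      fix X assume X: "X \<in> {X. skolem_closed B d X \<and> A \<subseteq> X}"
      then have "set xs \<subseteq> X" using xs by (auto simp: skolem_hull_def)
      with X show "skolem B d \<phi> n xs \<in> X" by (simp add: skolem_closed_def)
    qed
  qed (auto simp: skolem_hull_def skolem_closed_def)
qed

text \<open>The hull is exhausted in countably many rounds. A round applies countably many functions
  to finite lists, which does not lead beyond an infinite size.\<close>

lemma skolem_hull_lepoll:
  assumes "d \<in> B" "A \<subseteq> B" "infinite Z" "A \<lesssim> Z"
  shows "skolem_hull B d A \<lesssim> Z"
proof -
  define L where "L = rec_nat (insert d A)
    (\<lambda>_ Y. Y \<union> (\<lambda>(\<phi>, n, xs). skolem B d \<phi> n xs) ` (UNIV \<times> UNIV \<times> lists Y))"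
  have L0: "L 0 = insert d A"
    and LS: "L (Suc k) = L k \<union> (\<lambda>(\<phi>, n, xs). skolem B d \<phi> n xs) ` (UNIV \<times> UNIV \<times> lists (L k))" for k
    by (simp_all add: L_def)
  have "L k \<lesssim> Z" for k
  proof (induction k)
    case 0
    have "{d} \<union> A \<lesssim> Z"
      by (intro Un_lepoll_infinite assms finite_lepoll_infinite) simp
    then show ?case by (simp add: L0)
  next
    case (Suc k)
    have "(UNIV :: fm set) \<times> (UNIV :: nat set) \<times> lists (L k) \<lesssim> Z"
      by (intro Times_lepoll_infinite countable_lepoll_infinite lists_lepoll_infinite assms Suc) simp_all
    then show ?case
      unfolding LS by (intro Un_lepoll_infinite assms(3) Suc lepoll_trans[OF image_lepoll])
  qed
  then have "(\<Union>k. L k) \<lesssim> Z"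
    by (rule UN_lepoll_infinite[OF assms(3) countable_lepoll_infinite[OF assms(3)], rotated]) simp
  moreover have "skolem_hull B d A \<subseteq> (\<Union>k. L k)"
  proof -
    have mono: "L k \<subseteq> L m" if "k \<le> m" for k m
      using that by (induction rule: dec_induct) (auto simp: LS)
    have LB: "L k \<subseteq> B" for k
      by (induction k) (use assms(1,2) in \<open>auto simp: L0 LS skolem_in\<close>)
    have "skolem_closed B d (\<Union>k. L k)"
      unfolding skolem_closed_def
    proof (intro conjI allI impI)
      fix \<phi> n xs assume "set xs \<subseteq> (\<Union>k. L k)"
      then have "\<exists>k. set xs \<subseteq> L k"
      proof (induction xs)
        case (Cons x xs)
        then obtain i j where "set xs \<subseteq> L i" "x \<in> L j" by auto
        with mono[of i "max i j"] mono[of j "max i j"] show ?case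
          by (intro exI[of _ "max i j"]) auto
      qed auto
      then obtain k where "xs \<in> lists (L k)" by auto
      then have "skolem B d \<phi> n xs \<in> L (Suc k)" unfolding LS by force
      then show "skolem B d \<phi> n xs \<in> (\<Union>k. L k)" by blast
    qed (use LB L0 in auto)
    moreover have "A \<subseteq> (\<Union>k. L k)" using L0 by blast
    ultimately show ?thesis unfolding skolem_hull_def by (intro Inter_lower) simp
  qed
  ultimately show ?thesis using lepoll_trans[OF subset_imp_lepoll] by blast
qed


section \<open>Closure points\<close>

lemma least_Ord_eq:
  assumes "Ord a" "P a" "\<And>b. b \<in> elts a \<Longrightarrow> \<not> P b"
  shows "least_Ord P = a"
proof -
  note l = least_Ord[of a P, OF assms(1,2)]
  have "least_Ord P \<notin> elts a" using assms(3) l(2) by blast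
  then have "elts a \<subseteq> elts (least_Ord P)" using Ord_not_mem_iff[OF l(1) assms(1)] by simp
  with l(4) show ?thesis by (intro extensionality) auto
qed

lemma countable_lesspoll_uncountable:
  assumes "countable A" "uncountable B"
  shows "A \<prec> B"
proof -
  have "A \<lesssim> B" using assms by (intro countable_lepoll_infinite) (auto dest: countable_finite)
  moreover have "\<not> A \<approx> B" using countable_eqpoll[OF assms(1) eqpoll_sym] assms(2) by blast
  ultimately show ?thesis by (simp add: lesspoll_def)
qed

text \<open>Zero is vacuously closed and has to be excluded: the hulls indexed by the ordinals below
  the point are united, and this union must be nonempty.\<close>

definition closure_points :: "('a::zfc \<Rightarrow> 'a) \<Rightarrow> 'a \<Rightarrow> 'a set" where
  "closure_points h k = {a \<in> elts k. elts a \<noteq> {} \<and> (\<forall>b\<in>elts a. h b \<in> elts a)}"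

lemma club_closure_points:
  assumes "regular_cardinal k" "uncountable (elts k)" "h ` elts k \<subseteq> elts k"
  shows "club_in (closure_points h k) k"
proof -
  have k: "Card k" "Ord k" "infinite (elts k)" using assms(1) by (auto simp: regular_cardinal_def Card_Ord)
  have lim: "limit_Ord k" using infinite_Card_limit k by blast
  \<comment> \<open>One step of the climb: \<open>b\<close> lies above \<open>a\<close> and above
    all values of \<open>h\<close> on \<open>a\<close>. Regularity bounds these values.\<close>
  have "\<exists>b\<in>elts k. a \<in> elts b \<and> (\<forall>x\<in>elts a. h x \<in> elts b)" if a: "a \<in> elts k" for a
  proof -
    have "h ` elts a \<subseteq> elts k" using Ord_elts_subset[OF k(2) a] assms(3) by auto
    from regular_cardinal_no_cofinal[OF assms(1) a this]
    obtain d where d: "d \<in> elts k" "\<forall>x\<in>elts a. h x \<in> elts d" by blast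
    have s: "succ a \<in> elts k" by (rule limit_Ord_succ_mem) fact+
    show ?thesis
    proof (cases "a \<in> elts d")
      case False
      then have "elts d \<subseteq> elts (succ a)"
        using Ord_not_mem_iff[of a d] Ord_mem[OF k(2)] a d(1) by auto
      with d s show ?thesis by (intro bexI[of _ "succ a"]) (auto simp del: elts_succ simp: subset_iff, simp)
    qed (use d in auto)
  qed
  then obtain g where g: "\<And>a. a \<in> elts k \<Longrightarrow> g a \<in> elts k"
    "\<And>a. a \<in> elts k \<Longrightarrow> a \<in> elts (g a)"
    "\<And>a x. a \<in> elts k \<Longrightarrow> x \<in> elts a \<Longrightarrow> h x \<in> elts (g a)"
    by metis
  have "unbounded_in (closure_points h k) k"
    unfolding unbounded_in_def
  proof
    fix c assume c: "c \<in> elts k"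
    \<comment> \<open>The supremum of this countable sequence is closed, since \<open>h\<close> on
      each member is bounded by the next one. It stays below \<open>k\<close> because
      \<open>k\<close> is regular and uncountable.\<close>
    define s where "s n = (g ^^ n) c" for n
    have sS: "s (Suc n) = g (s n)" and s0: "s 0 = c" for n by (simp_all add: s_def)
    have s: "s n \<in> elts k" for n by (induction n) (auto simp: s0 sS c g)
    have "range s \<prec> elts k" by (rule countable_lesspoll_uncountable) (use assms in auto)
    with s obtain d where d: "d \<in> elts k" "\<forall>y\<in>range s. y \<in> elts d"
      using regular_cardinal_bounded[OF assms(1), of "range s"] by blast
    define a where "a = vset (\<Union>x\<in>range s. elts x)"
    have a: "elts a = (\<Union>n. elts (s n))"
      unfolding a_def by (subst elts_vset) (auto intro!: small_UN[of "range s" elts, simplified] small_range_nat)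
    have "Ord a" unfolding a_def by (rule Ord_Union) (use s Ord_mem[OF k(2)] small_range_nat in auto)
    moreover have "Ord d" using Ord_mem k(2) d(1) by blast
    moreover have "elts a \<subseteq> elts d" using d(2) Ord_trans[OF \<open>Ord d\<close>] unfolding a by blast
    ultimately have "a \<in> elts k"
      using Ord_linear[of a d] mem_irrefl[of d] d(1) Ord_trans[OF k(2) d(1), of a] by blast
    moreover have "c \<in> elts a" using g(2)[OF c] sS[of 0] s0 unfolding a by (metis UN_I UNIV_I)
    moreover have "h x \<in> elts a" if "x \<in> elts a" for x
    proof -
      from that obtain n where "x \<in> elts (s n)" by (auto simp: a)
      from g(3)[OF s this] show ?thesis unfolding a sS[symmetric] by blast
    qed
    ultimately show "\<exists>b\<in>closure_points h k \<inter> elts k. c \<in> elts b"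
      by (intro bexI[of _ a]) (auto simp: closure_points_def)
  qed
  moreover have "a \<in> closure_points h k"
    if "a \<in> elts k" "limit_Ord a" "unbounded_in (closure_points h k) a" for a
  proof -
    have "h x \<in> elts a" if x: "x \<in> elts a" for x
    proof -
      obtain c where c: "c \<in> closure_points h k" "c \<in> elts a" "x \<in> elts c"
        using x \<open>unbounded_in (closure_points h k) a\<close> unfolding unbounded_in_def by blast
      then have "h x \<in> elts c" by (auto simp: closure_points_def)
      with c Ord_trans[OF Ord_mem[OF k(2) \<open>a \<in> elts k\<close>]] show ?thesis by blast
    qed
    then show ?thesis using that by (auto simp: closure_points_def limit_Ord_def)
  qed
  ultimately show ?thesis unfolding club_in_def closure_points_def by blast
qed

lemma club_inter_closure_points:
  assumes "regular_cardinal k" "uncountable (elts k)" "h ` elts k \<subseteq> elts k" "stationary_in S k"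
  shows "\<exists>a\<in>closure_points h k. a \<in> S"
  using club_closure_points[OF assms(1-3)] assms(4) unfolding stationary_in_def by blast

lemma closure_points_nonempty:
  assumes "regular_cardinal k" "uncountable (elts k)" "h ` elts k \<subseteq> elts k"
  shows "closure_points h k \<noteq> {}"
proof -
  have "elts k \<noteq> {}" using assms(2) by auto
  then show ?thesis using club_closure_points[OF assms] unfolding club_in_def unbounded_in_def by blast
qed


section \<open>Small embeddings from elementary submodels\<close>

text \<open>Because \<open>X\<close> meets \<open>k\<close> in the initial segment \<open>a\<close>,
  the collapse fixes every ordinal below \<open>a\<close> and sends \<open>k\<close> to
  \<open>a\<close>. Its inverse therefore moves no ordinal below \<open>a\<close> and takes
  \<open>a\<close> to \<open>k\<close>.\<close>

lemma collapse_small_embedding: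
  assumes k: "Card k" "Card t" "k \<in> elts t"
    and X: "X \<subseteq> H t" "X \<prec> elts t" "k \<in> X" "X \<inter> elts k = elts a" "a \<in> elts k"
    and elem: "\<And>\<phi> e. range e \<subseteq> X \<Longrightarrow> sat X \<phi> e \<longleftrightarrow> sat (H t) \<phi> e"
  shows "\<exists>M j. small_embedding k t M j \<and> crit (elts M) j = a"
proof -
  have "small X" using small_lepoll[OF small_elts lesspoll_imp_lepoll[OF X(2)]] .
  define r where "r = {(y, x). x \<in> X \<and> y \<in> X \<and> y \<in> elts x}"
  interpret collapsible r X
  proof
    show "wf r" by (rule wf_subset[OF wf_mem]) (auto simp: r_def)
    show "x = y" if xy: "x \<in> X" "y \<in> X" "\<And>z. (z, x) \<in> r \<longleftrightarrow> (z, y) \<in> r" for x y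
    proof (rule ccontr)
      assume "x \<noteq> y"
      then obtain z where "(z \<in> elts x) \<noteq> (z \<in> elts y)" using extensionality by blast
      moreover from this have "z \<in> H t" using transitive_H[of t] xy X(1) unfolding transitive_class_def by blast
      \<comment> \<open>The formula says that some element tells variables 0 and 1 apart. By
        transitivity it holds in H(\<theta>), so by elementarity a distinguishing element lies in
        \<open>X\<close>, which makes membership on \<open>X\<close> extensional.\<close>
      moreover define \<phi> where "\<phi> = Exists 2 (Neg (Disj (Conj (Mem 2 0) (Mem 2 1)) (Conj (Neg (Mem 2 0)) (Neg (Mem 2 1)))))"
      ultimately have "sat (H t) \<phi> ((\<lambda>_. x)(1 := y))" by auto
      then have "sat X \<phi> ((\<lambda>_. x)(1 := y))" using xy by (subst elem) auto
      then show False using xy by (auto simp: \<phi>_def r_def)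
    qed
  qed (use \<open>small X\<close> in \<open>auto simp: r_def\<close>)
  define \<pi> where "\<pi> = collapse r"
  define M where "M = vset (\<pi> ` X)"
  define j where "j = inv_into X \<pi>"
  have M: "elts M = \<pi> ` X" unfolding M_def by (rule elts_vset[OF small_image[OF \<open>small X\<close>]])
  have inj: "inj_on \<pi> X" unfolding \<pi>_def by (rule inj_on_collapse)
  have j\<pi>: "j (\<pi> x) = x" if "x \<in> X" for x unfolding j_def using inj that by simp
  have elts_\<pi>: "elts (\<pi> x) = \<pi> ` (X \<inter> elts x)" if "x \<in> X" for x
    unfolding \<pi>_def elts_collapse using that by (auto simp: r_def)
  have mem_\<pi>: "\<pi> x \<in> elts (\<pi> y) \<longleftrightarrow> x \<in> elts y" if "x \<in> X" "y \<in> X" for x y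
    using collapse_mem_iff[OF that] that by (simp add: \<pi>_def r_def)
  have trans: "transitive_class (elts M)" unfolding M \<pi>_def by (rule transitive_collapse)
  have "Ord k" "Ord a" using k(1) X(5) Card_Ord Ord_mem by blast+
  have \<pi>_id: "\<pi> b = b" if "b \<in> elts a" for b
    using that
  proof (induction b rule: mem_induct)
    case (step b)
    have sub: "elts b \<subseteq> elts a" using Ord_elts_subset[OF \<open>Ord a\<close> step.prems] .
    then have "X \<inter> elts b = elts b" using X(4) by blast
    moreover have "b \<in> X" using step.prems X(4) by blast
    ultimately have "elts (\<pi> b) = \<pi> ` elts b" by (simp add: elts_\<pi>)
    also have "\<dots> = elts b" using step.IH sub by force
    finally show ?case by (rule extensionality)
  qed
  have \<pi>k: "\<pi> k = a"
  proof (rule extensionality)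
    have "elts (\<pi> k) = \<pi> ` elts a" using elts_\<pi>[OF X(3)] X(4) by simp
    then show "elts (\<pi> k) = elts a" using \<pi>_id by force
  qed
  have ja: "j a = k" using j\<pi>[OF X(3)] \<pi>k by simp
  have jb: "j b = b" if "b \<in> elts a" for b
    using j\<pi>[of b] \<pi>_id[OF that] X(4) that by auto
  have aM: "a \<in> elts M" unfolding M using X(3) \<pi>k by blast
  have crit: "crit (elts M) j = a"
    unfolding crit_def
  proof (rule least_Ord_eq)
    show "a \<in> elts M \<and> a \<in> elts (j a)" using aM ja X(5) by simp
    show "\<not> (b \<in> elts M \<and> b \<in> elts (j b))" if "b \<in> elts a" for b
      using jb[OF that] mem_irrefl[of b] by simp
  qed fact
  have "elementary_embedding (elts M) (H t) j"
    unfolding elementary_embedding_def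
  proof (intro conjI allI impI)
    show "j ` elts M \<subseteq> H t" using j\<pi> X(1) by (auto simp: M)
    fix \<phi> and e :: "nat \<Rightarrow> 'a" assume e: "range e \<subseteq> elts M"
    have ei: "\<exists>x\<in>X. e i = \<pi> x" for i using e unfolding M by blast
    have "j (e i) \<in> X" for i using ei[of i] j\<pi> by auto
    then have je: "range (j \<circ> e) \<subseteq> X" by auto
    have "\<pi> (j (e i)) = e i" for i using ei[of i] j\<pi> by auto
    then have "\<pi> \<circ> (j \<circ> e) = e" by (auto simp: o_def)
    then have "sat (elts M) \<phi> e \<longleftrightarrow> sat (\<pi> ` X) \<phi> (\<pi> \<circ> (j \<circ> e))" by (simp add: M)
    also have "\<dots> \<longleftrightarrow> sat X \<phi> (j \<circ> e)" by (rule sat_isomorphism[OF inj mem_\<pi> je])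
    also have "\<dots> \<longleftrightarrow> sat (H t) \<phi> (j \<circ> e)" by (rule elem[OF je])
    finally show "sat (elts M) \<phi> e \<longleftrightarrow> sat (H t) \<phi> (j \<circ> e)" .
  qed
  moreover have "nontrivial_embedding (elts M) j"
    unfolding nontrivial_embedding_def using aM ja X(5) \<open>Ord a\<close> by auto
  moreover have "M \<in> H t"
  proof (rule H_I[OF _ trans])
    show "elts M \<prec> elts t" unfolding M by (rule lesspoll_trans1[OF image_lepoll X(2)])
  qed auto
  ultimately have "small_embedding k t M j" using k trans crit ja by (simp add: small_embedding_def)
  with crit show ?thesis by blast
qed

text \<open>The hypothesis on \<open>P\<close> isolates what each of the five properties has to
  contribute. It quantifies over all \<open>h\<close>, because the relevant function comes from the
  hulls and hence depends on \<open>t\<close>.\<close>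

lemma regular_small_embedding:
  assumes "regular_cardinal k" "uncountable (elts k)" "Card t" "k \<in> elts t"
    and P: "\<And>h. h ` elts k \<subseteq> elts k \<Longrightarrow> \<exists>a\<in>closure_points h k. P a"
  shows "\<exists>M j. small_embedding k t M j \<and> P (crit (elts M) j)"
proof -
  have k: "Card k" "Ord k" "infinite (elts k)" using assms(1) by (auto simp: regular_cardinal_def Card_Ord)
  have kt: "elts k \<prec> elts t" by (rule Card_mem_lesspoll) fact+
  have sub: "elts k \<subseteq> H t" and kB: "k \<in> H t"
  proof -
    have tr: "transitive_class (elts k)" using k(2) by (simp add: Ord_def)
    have "k \<in> H t" by (rule H_I[OF small_elts tr _ kt]) simp
    then show "k \<in> H t" "elts k \<subseteq> H t" using transitive_H[of t] by (auto simp: transitive_class_def)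
  qed
  \<comment> \<open>Using \<open>succ b\<close> puts \<open>b\<close> itself into
    \<open>G b\<close>, so the union over \<open>b < a\<close> contains all of \<open>a\<close>; the
    default value \<open>k\<close> puts \<open>k\<close> into every \<open>G b\<close>.\<close>
  define G where "G b = skolem_hull (H t) k (elts (succ b))" for b
  have lim: "limit_Ord k" using infinite_Card_limit k by blast
  have succ_sub: "elts (succ b) \<subseteq> elts k" if "b \<in> elts k" for b
    using Ord_elts_subset[OF k(2) limit_Ord_succ_mem[OF lim that]] .
  have G: "skolem_closed (H t) k (G b)" if "b \<in> elts k" for b
    unfolding G_def by (rule skolem_closed_hull[OF kB]) (use succ_sub[OF that] sub in blast)
  have Gk: "G b \<prec> elts k" if b: "b \<in> elts k" for b
  proof -
    \<comment> \<open>A hull can be infinite even over a finite set of generators, so its size is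
      measured by some \<open>z < k\<close> that also lies above a limit ordinal
      \<open>w\<close>.\<close>
    obtain w where w: "w \<in> elts k" "limit_Ord w" using uncountable_Card_mem_limit k assms(2) by blast
    have sb: "succ b \<in> elts k" using limit_Ord_succ_mem[OF lim b] .
    have "\<exists>z\<in>elts k. elts w \<subseteq> elts z \<and> elts (succ b) \<subseteq> elts z"
    proof (cases "succ b \<in> elts w")
      case True
      then have "elts (succ b) \<subseteq> elts w" using Ord_elts_subset w Ord_mem k(2) by blast
      with w show ?thesis by blast
    next
      case False
      then have "elts w \<subseteq> elts (succ b)" using Ord_not_mem_iff[of "succ b" w] Ord_mem[OF k(2)] w sb by blast
      with sb show ?thesis by blast
    qed
    then obtain z where z: "z \<in> elts k" "elts w \<subseteq> elts z" "elts (succ b) \<subseteq> elts z" by blast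
    have "infinite (elts z)" using z(2) limit_Ord_infinite[OF w(2)] finite_subset by blast
    then have "G b \<lesssim> elts z"
      unfolding G_def using succ_sub[OF b] sub z(3)
      by (intro skolem_hull_lepoll kB subset_imp_lepoll) auto
    then show ?thesis by (rule lesspoll_trans1) (rule Card_mem_lesspoll[OF k(1) z(1)])
  qed
  \<comment> \<open>The resulting \<open>h b\<close> lies strictly above all ordinals of
    \<open>G b\<close> below \<open>k\<close>. If \<open>a\<close> is closed under \<open>h\<close>,
    the union of the hulls has no ordinals in the interval from \<open>a\<close> to
    \<open>k\<close>.\<close>
  have "\<exists>d\<in>elts k. \<forall>y\<in>G b \<inter> elts k. y \<in> elts d" if "b \<in> elts k" for b
    by (rule regular_cardinal_bounded[OF assms(1) _ subset_lesspoll[OF _ Gk[OF that]]]) auto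
  then obtain h where h: "\<And>b. b \<in> elts k \<Longrightarrow> h b \<in> elts k"
    "\<And>b y. b \<in> elts k \<Longrightarrow> y \<in> G b \<Longrightarrow> y \<in> elts k \<Longrightarrow> y \<in> elts (h b)"
    by (metis IntI)
  then obtain a where a: "a \<in> closure_points h k" "P a" using P[of h] by blast
  then have ak: "a \<in> elts k" "elts a \<noteq> {}" and ha: "\<And>b. b \<in> elts a \<Longrightarrow> h b \<in> elts a"
    by (auto simp: closure_points_def)
  have "Ord a" using Ord_mem[OF k(2) ak(1)] .
  have a_sub: "elts a \<subseteq> elts k" using Ord_elts_subset[OF k(2) ak(1)] .
  define X where "X = (\<Union>b\<in>elts a. G b)"
  have X: "skolem_closed (H t) k X"
    unfolding X_def
  proof (rule skolem_closed_chain_UN[OF ak(2)])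
    fix b c assume bc: "b \<in> elts a" "c \<in> elts a"
    then have o: "Ord b" "Ord c" using Ord_mem[OF \<open>Ord a\<close>] by auto
    have "elts (succ b) \<subseteq> elts (succ c) \<or> elts (succ c) \<subseteq> elts (succ b)"
      using Ord_not_mem_iff[OF Ord_succ[OF o(1)] Ord_succ[OF o(2)]] Ord_elts_subset[OF Ord_succ[OF o(2)]] by blast
    then show "G b \<subseteq> G c \<or> G c \<subseteq> G b" unfolding G_def using skolem_hull_mono by blast
  qed (use G a_sub in blast)
  have "X \<lesssim> elts k"
    unfolding X_def
  proof (rule UN_lepoll_infinite[OF k(3) subset_imp_lepoll[OF a_sub]])
    fix b assume "b \<in> elts a"
    then show "G b \<lesssim> elts k" using a_sub lesspoll_imp_lepoll[OF Gk] by blast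
  qed
  then have "X \<prec> elts t" by (rule lesspoll_trans1[OF _ kt])
  moreover have "X \<inter> elts k = elts a"
  proof
    show "X \<inter> elts k \<subseteq> elts a"
    proof
      fix y assume "y \<in> X \<inter> elts k"
      then obtain b where b: "b \<in> elts a" "y \<in> G b" "y \<in> elts k" by (auto simp: X_def)
      then have "y \<in> elts (h b)" using h(2) a_sub by blast
      then show "y \<in> elts a" using Ord_trans[OF \<open>Ord a\<close> ha[OF b(1)]] by blast
    qed
    have "b \<in> G b" for b
      unfolding G_def by (rule subsetD[OF skolem_hull_superset]) simp
    then show "elts a \<subseteq> X \<inter> elts k" using a_sub by (auto simp: X_def)
  qed
  moreover have "X \<subseteq> H t" "k \<in> X" using X by (auto simp: skolem_closed_def)
  ultimately obtain M j where "small_embedding k t M j" "crit (elts M) j = a"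
    using collapse_small_embedding[OF k(1) assms(3,4), of X a] ak(1) skolem_closed_elementary[OF X] by blast
  with a(2) show ?thesis by blast
qed


section \<open>Closure points that are cardinals\<close>

lemma closure_points_Int:
  assumes "Ord k" "h ` elts k \<subseteq> elts k" "g ` elts k \<subseteq> elts k"
  shows "\<exists>f. f ` elts k \<subseteq> elts k \<and> closure_points f k \<subseteq> closure_points h k \<inter> closure_points g k"
proof -
  \<comment> \<open>The larger of the two values. Closure under it implies closure under both, since
    an ordinal contains everything below its elements.\<close>
  define f where "f b = (if h b \<in> elts (g b) then g b else h b)" for b
  have "closure_points f k \<subseteq> closure_points h k \<inter> closure_points g k"
  proof
    fix a assume a: "a \<in> closure_points f k"
    then have ak: "a \<in> elts k" "Ord a" using Ord_mem[OF assms(1)] by (auto simp: closure_points_def)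
    have "h b \<in> elts a \<and> g b \<in> elts a" if b: "b \<in> elts a" for b
    proof -
      have fb: "f b \<in> elts a" using a b by (auto simp: closure_points_def)
      have "b \<in> elts k" using Ord_trans[OF assms(1) ak(1) b] .
      then have o: "Ord (h b)" "Ord (g b)" using assms(2,3) Ord_mem[OF assms(1)] by auto
      show ?thesis
      proof (cases "h b \<in> elts (g b)")
        case True
        then show ?thesis using fb Ord_trans[OF ak(2)] unfolding f_def by auto
      next
        case False
        then have "h b \<in> elts a" "g b = h b \<or> g b \<in> elts (h b)"
          using fb Ord_linear[OF o] unfolding f_def by auto
        then show ?thesis using Ord_trans[OF ak(2)] by auto
      qed
    qed
    with a show "a \<in> closure_points h k \<inter> closure_points g k" by (auto simp: closure_points_def)
  qed
  moreover have "f ` elts k \<subseteq> elts k" using assms(2,3) by (auto simp: f_def)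
  ultimately show ?thesis by blast
qed

lemma closure_points_meet:
  assumes "regular_cardinal k" "uncountable (elts k)" "h ` elts k \<subseteq> elts k" "g ` elts k \<subseteq> elts k"
  shows "\<exists>a\<in>closure_points h k. a \<in> closure_points g k"
proof -
  have "Ord k" using assms(1) by (simp add: regular_cardinal_def Card_Ord)
  then obtain f where "f ` elts k \<subseteq> elts k" "closure_points f k \<subseteq> closure_points h k \<inter> closure_points g k"
    using closure_points_Int[OF _ assms(3,4)] by auto
  with closure_points_nonempty[OF assms(1,2), of f] show ?thesis by blast
qed

lemma Ord_eqpoll_Card:
  assumes "Ord b"
  obtains c :: "'a::zfc" where "Card c" "elts c \<approx> elts b" "elts c \<subseteq> elts b"
proof -
  obtain c :: 'a where c: "Card c" "elts c \<approx> elts b" using small_eqpoll_Card[OF small_elts] by blast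
  have "b \<notin> elts c" using c(1) eqpoll_sym[OF c(2)] unfolding Card_def by blast
  then have "elts c \<subseteq> elts b" using Ord_not_mem_iff[OF assms Card_Ord[OF c(1)]] by blast
  with c that show ?thesis by blast
qed

lemma Ord_subset_mem_trans: "Ord k \<Longrightarrow> Ord c \<Longrightarrow> elts c \<subseteq> elts b \<Longrightarrow> b \<in> elts k \<Longrightarrow> c \<in> elts k"
  using Ord_linear[of c k] mem_asym[of b k] mem_irrefl[of b] by auto

text \<open>The definition of a limit cardinal speaks of cardinals only; an arbitrary ordinal
  \<open>b\<close> is handled by passing to its cardinality.\<close>

lemma limit_cardinal_next:
  assumes "limit_cardinal k" "b \<in> elts k"
  shows "\<exists>n\<in>elts k. Card n \<and> b \<in> elts n"
proof -
  have k: "Card k" "Ord k" using assms(1) by (auto simp: limit_cardinal_def Card_Ord)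
  have "Ord b" using Ord_mem[OF k(2) assms(2)] .
  then obtain c where c: "Card c" "elts c \<approx> elts b" "elts c \<subseteq> elts b" by (rule Ord_eqpoll_Card)
  have "c \<in> elts k" using Ord_subset_mem_trans[OF k(2) Card_Ord[OF c(1)] c(3) assms(2)] .
  then obtain n where n: "n \<in> elts k" "Card n" "c \<in> elts n"
    using assms(1) c(1) unfolding limit_cardinal_def by blast
  have "elts b \<prec> elts n" by (rule eq_lesspoll_trans[OF eqpoll_sym[OF c(2)] Card_mem_lesspoll[OF n(2,3)]])
  then have "b \<in> elts n" using Ord_lesspoll_mem[OF Card_Ord[OF n(2)] \<open>Ord b\<close>] by blast
  with n show ?thesis by blast
qed

lemma limit_of_Cards_Card:
  assumes "Ord a" "\<And>b. b \<in> elts a \<Longrightarrow> \<exists>n\<in>elts a. Card n \<and> b \<in> elts n"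
  shows "Card a"
  unfolding Card_def
proof (intro conjI ballI)
  fix b assume "b \<in> elts a"
  then obtain n where n: "n \<in> elts a" "Card n" "b \<in> elts n" using assms(2) by blast
  have "elts b \<prec> elts a"
    by (rule lesspoll_trans2[OF Card_mem_lesspoll[OF n(2,3)] subset_imp_lepoll[OF Ord_elts_subset[OF assms(1) n(1)]]])
  then show "\<not> elts b \<approx> elts a" by (simp add: lesspoll_def)
qed fact

text \<open>If \<open>g b\<close> is a cardinal above \<open>b\<close>, the closure points of
  \<open>g\<close> are limits of cardinals, hence cardinals; some point is closed under both
  \<open>g\<close> and \<open>h\<close>.\<close>

lemma weakly_inaccessible_closure_point_Card:
  assumes "weakly_inaccessible k" "h ` elts k \<subseteq> elts k"
  shows "\<exists>a\<in>closure_points h k. Card a"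
proof -
  have k: "regular_cardinal k" "uncountable (elts k)" "limit_cardinal k"
    using assms(1) by (auto simp: weakly_inaccessible_def)
  then have "Ord k" by (simp add: regular_cardinal_def Card_Ord)
  obtain g where g: "\<And>b. b \<in> elts k \<Longrightarrow> g b \<in> elts k \<and> Card (g b) \<and> b \<in> elts (g b)"
    using limit_cardinal_next[OF k(3)] by metis
  then have "g ` elts k \<subseteq> elts k" by blast
  from closure_points_meet[OF k(1,2) assms(2) this]
  obtain a where a: "a \<in> closure_points h k" "a \<in> closure_points g k" by blast
  then have "a \<in> elts k" by (simp add: closure_points_def)
  have "Card a"
  proof (rule limit_of_Cards_Card)
    show "Ord a" using Ord_mem[OF \<open>Ord k\<close> \<open>a \<in> elts k\<close>] .
    show "\<exists>n\<in>elts a. Card n \<and> b \<in> elts n" if "b \<in> elts a" for b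
      using that a(2) g[of b] Ord_trans[OF \<open>Ord k\<close> \<open>a \<in> elts k\<close> that] by (auto simp: closure_points_def)
  qed
  with a(1) show ?thesis by blast
qed

lemma Pow_lepoll_mono: "A \<lesssim> B \<Longrightarrow> Pow A \<lesssim> Pow B"
  unfolding lepoll_def by (meson image_Pow_mono inj_on_image_Pow)

lemma strong_limit_Pow:
  assumes "strong_limit_cardinal k" "b \<in> elts k"
  shows "Pow (elts b) \<prec> elts k"
proof -
  have k: "Card k" "Ord k" using assms(1) by (auto simp: strong_limit_cardinal_def Card_Ord)
  obtain c where c: "Card c" "elts c \<approx> elts b" "elts c \<subseteq> elts b"
    using Ord_eqpoll_Card[OF Ord_mem[OF k(2) assms(2)]] by metis
  have "c \<in> elts k" using Ord_subset_mem_trans[OF k(2) Card_Ord[OF c(1)] c(3) assms(2)] .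
  then have "Pow (elts c) \<prec> elts k" using assms(1) c(1) by (auto simp: strong_limit_cardinal_def)
  moreover have "Pow (elts b) \<lesssim> Pow (elts c)"
    by (rule Pow_lepoll_mono[OF eqpoll_imp_lepoll[OF eqpoll_sym[OF c(2)]]])
  ultimately show ?thesis using lesspoll_trans1 by blast
qed

text \<open>Here \<open>g b\<close> is the cardinality of the power set of \<open>b\<close>, which
  exceeds \<open>b\<close> by Cantor's theorem. Closure under \<open>g\<close> thus gives both a
  limit of cardinals and the strong limit property.\<close>

lemma inaccessible_closure_point_strong_limit:
  assumes "inaccessible k" "h ` elts k \<subseteq> elts k"
  shows "\<exists>a\<in>closure_points h k. strong_limit_cardinal a"
proof -
  have k: "regular_cardinal k" "uncountable (elts k)" "strong_limit_cardinal k"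
    using assms(1) by (auto simp: inaccessible_def)
  then have "Ord k" by (simp add: regular_cardinal_def Card_Ord)
  have "\<exists>n\<in>elts k. Card n \<and> elts n \<approx> Pow (elts b)" if b: "b \<in> elts k" for b
  proof -
    obtain n :: 'a where n: "Card n" "elts n \<approx> {z. elts z \<subseteq> elts b}"
      using small_eqpoll_Card[OF small_Pow] by blast
    have e: "elts n \<approx> Pow (elts b)" by (rule eqpoll_trans[OF n(2) subsets_eqpoll_Pow])
    have "elts n \<prec> elts k" by (rule eq_lesspoll_trans[OF e strong_limit_Pow[OF k(3) b]])
    then have "n \<in> elts k" by (rule Ord_lesspoll_mem[OF \<open>Ord k\<close> Card_Ord[OF n(1)]])
    with n(1) e show ?thesis by blast
  qed
  then obtain g where g: "\<And>b. b \<in> elts k \<Longrightarrow> g b \<in> elts k"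
    "\<And>b. b \<in> elts k \<Longrightarrow> Card (g b)" "\<And>b. b \<in> elts k \<Longrightarrow> elts (g b) \<approx> Pow (elts b)"
    by metis
  then have "g ` elts k \<subseteq> elts k" by blast
  from closure_points_meet[OF k(1,2) assms(2) this]
  obtain a where a: "a \<in> closure_points h k" "a \<in> closure_points g k" by blast
  then have ak: "a \<in> elts k" "elts a \<noteq> {}" and ga: "\<And>b. b \<in> elts a \<Longrightarrow> g b \<in> elts a"
    by (auto simp: closure_points_def)
  have "Ord a" using Ord_mem[OF \<open>Ord k\<close> ak(1)] .
  have bk: "b \<in> elts k" if "b \<in> elts a" for b using Ord_trans[OF \<open>Ord k\<close> ak(1) that] .
  have g_mem: "b \<in> elts (g b)" if b: "b \<in> elts a" for b
  proof (rule Ord_lesspoll_mem)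
    show "Ord (g b)" "Ord b" using g(1) bk[OF b] Ord_mem[OF \<open>Ord k\<close>] by blast+
    show "elts b \<prec> elts (g b)"
      by (rule lesspoll_eq_trans[OF lesspoll_Pow_self eqpoll_sym[OF g(3)[OF bk[OF b]]]])
  qed
  have "Card a"
    by (rule limit_of_Cards_Card[OF \<open>Ord a\<close>]) (use ga g(2) bk g_mem in blast)
  moreover have "limit_Ord a" unfolding limit_Ord_def using \<open>Ord a\<close> ak(2) ga g_mem by blast
  moreover have "Pow (elts b) \<prec> elts a" if b: "b \<in> elts a" for b
    by (rule eq_lesspoll_trans[OF eqpoll_sym[OF g(3)[OF bk[OF b]]] Card_mem_lesspoll[OF \<open>Card a\<close> ga[OF b]]])
  ultimately have "strong_limit_cardinal a"
    by (simp add: strong_limit_cardinal_def limit_Ord_infinite)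
  with a(1) show ?thesis by blast
qed


section \<open>Coding by sets of unordered pairs\<close>

text \<open>
  A relation between two disjoint sets of ordinals can be coded by unordered pairs, which keeps the
  formulas short. To make domain and range disjoint, cofinal maps defined on \<open>d\<close> take values outside
  \<open>d\<close>, and an injection of \<open>k\<close> into \<open>m\<close> or its power set is only coded on \<open>k - m\<close>.
\<close>

definition linked :: "'a::zfc \<Rightarrow> 'a \<Rightarrow> 'a \<Rightarrow> bool" where
  "linked F x y \<longleftrightarrow> (\<exists>p\<in>elts F. x \<in> elts p \<and> y \<in> elts p)"

definition values_bounded :: "'a::zfc \<Rightarrow> 'a \<Rightarrow> 'a \<Rightarrow> 'a \<Rightarrow> 'a \<Rightarrow> bool" where
  "values_bounded F d k x y \<longleftrightarrow>
    (\<forall>z\<in>elts k. z \<in> elts d \<or> \<not> linked F x z \<or> z \<in> elts y \<or> z = y)"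

text \<open>In place of single-valuedness, every argument below \<open>d\<close> comes with a bound
  in \<open>k\<close> for all values linked to it. The bounds form a map from \<open>d\<close> that
  is cofinal whenever the linked values are unbounded.\<close>

definition codes_cofinal_map :: "'a::zfc \<Rightarrow> 'a \<Rightarrow> 'a \<Rightarrow> bool" where
  "codes_cofinal_map F d k \<longleftrightarrow>
    (\<forall>b\<in>elts k. \<exists>x\<in>elts d. \<exists>y\<in>elts k. y \<notin> elts d \<and> linked F x y \<and> b \<in> elts y) \<and>
    (\<forall>x\<in>elts d. \<exists>y\<in>elts k. values_bounded F d k x y)"

definition codes_injection :: "'a::zfc \<Rightarrow> 'a \<Rightarrow> 'a \<Rightarrow> bool" where
  "codes_injection F m k \<longleftrightarrow>
    (\<forall>x\<in>elts k. x \<in> elts m \<or>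
      (\<exists>z\<in>elts m. linked F x z \<and> (\<forall>y\<in>elts k. y \<in> elts m \<or> y = x \<or> \<not> linked F y z)))"

text \<open>The subset assigned to \<open>x\<close> is the set of all \<open>z\<close> in
  \<open>m\<close> linked to \<open>x\<close>.\<close>

definition codes_injection_Pow :: "'a::zfc \<Rightarrow> 'a \<Rightarrow> 'a \<Rightarrow> bool" where
  "codes_injection_Pow F m k \<longleftrightarrow>
    (\<forall>x\<in>elts k. \<forall>y\<in>elts k. x \<in> elts m \<or> y \<in> elts m \<or> x = y \<or>
      (\<exists>z\<in>elts m. \<not> (linked F x z \<longleftrightarrow> linked F y z)))"

text \<open>In the formulas below, variable 0 is \<open>k\<close>, variable 1 is \<open>d\<close> or \<open>m\<close>, and variable 2 is \<open>F\<close>.\<close>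

definition fm_linked :: "nat \<Rightarrow> nat \<Rightarrow> nat \<Rightarrow> nat \<Rightarrow> fm" where
  "fm_linked n F x y = BEx n F (Conj (Mem x n) (Mem y n))"

text \<open>Variables 3 and 4, the argument and its bound, stay free, so the formula serves both
  inside \<open>fm_cofinal_map\<close> and alone, with parameters that j fixes.\<close>

definition "fm_values_bounded =
  BAll 5 0 (Disj (Mem 5 1) (Disj (Neg (fm_linked 6 2 3 5)) (Disj (Mem 5 4) (Equal 5 4))))"

definition "fm_cofinal_map = Conj
  (BAll 3 0 (BEx 4 1 (BEx 5 0 (Conj (Neg (Mem 5 1)) (Conj (fm_linked 6 2 4 5) (Mem 3 5))))))
  (BAll 3 1 (BEx 4 0 fm_values_bounded))"

definition "fm_injection = BAll 3 0 (Disj (Mem 3 1)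
  (BEx 5 1 (Conj (fm_linked 6 2 3 5)
    (BAll 4 0 (Disj (Mem 4 1) (Disj (Equal 4 3) (Neg (fm_linked 6 2 4 5))))))))"

definition "fm_injection_Pow =
  BAll 3 0 (BAll 4 0 (Disj (Mem 3 1) (Disj (Mem 4 1) (Disj (Equal 3 4)
    (BEx 5 1 (Neg (Disj (Conj (fm_linked 6 2 3 5) (fm_linked 6 2 4 5))
      (Neg (Disj (fm_linked 6 2 3 5) (fm_linked 6 2 4 5))))))))))"

text \<open>Nonempty and without a largest element, which characterizes limits among ordinals.
  \<open>Equal 8 8\<close> is a dummy truth; the bound variables 8 and 9 leave all smaller ones
  available for \<open>n\<close>.\<close>

definition fm_limit :: "nat \<Rightarrow> fm" where
  "fm_limit n = Conj (BEx 8 n (Equal 8 8)) (BAll 8 n (BEx 9 n (Mem 8 9)))"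

lemma delta0_fms:
  "delta0 fm_values_bounded" "delta0 fm_cofinal_map" "delta0 fm_injection" "delta0 fm_injection_Pow"
  "n < 8 \<Longrightarrow> delta0 (fm_limit n)"
  unfolding fm_values_bounded_def fm_cofinal_map_def fm_injection_def fm_injection_Pow_def
    fm_limit_def fm_linked_def
  by (intro delta0_intros; simp)+

lemma sat_fm_values_bounded: "sat UNIV fm_values_bounded e \<longleftrightarrow> values_bounded (e 2) (e 1) (e 0) (e 3) (e 4)"
  by (simp add: fm_values_bounded_def values_bounded_def fm_linked_def linked_def)

lemma sat_fm_cofinal_map: "sat UNIV fm_cofinal_map e \<longleftrightarrow> codes_cofinal_map (e 2) (e 1) (e 0)"
  by (simp add: fm_cofinal_map_def codes_cofinal_map_def sat_fm_values_bounded fm_linked_def linked_def)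

lemma sat_fm_injection: "sat UNIV fm_injection e \<longleftrightarrow> codes_injection (e 2) (e 1) (e 0)"
  by (simp add: fm_injection_def codes_injection_def fm_linked_def linked_def)

lemma sat_fm_injection_Pow: "sat UNIV fm_injection_Pow e \<longleftrightarrow> codes_injection_Pow (e 2) (e 1) (e 0)"
  unfolding fm_injection_Pow_def codes_injection_Pow_def fm_linked_def linked_def by simp blast

lemma sat_fm_limit: "n < 8 \<Longrightarrow> Ord (e n) \<Longrightarrow> sat UNIV (fm_limit n) e \<longleftrightarrow> limit_Ord (e n)"
  by (auto simp: fm_limit_def limit_Ord_def)

lemma codes_cofinal_map_not_regular:
  assumes "codes_cofinal_map F d k" "d \<in> elts k"
  shows "\<not> regular_cardinal k"
proof
  assume reg: "regular_cardinal k"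
  have "\<forall>x\<in>elts d. \<exists>y\<in>elts k. values_bounded F d k x y"
    using assms(1) by (simp add: codes_cofinal_map_def)
  then obtain f where f: "\<And>x. x \<in> elts d \<Longrightarrow> f x \<in> elts k"
    "\<And>x. x \<in> elts d \<Longrightarrow> values_bounded F d k x (f x)" by metis
  obtain b where b: "b \<in> elts k" "\<And>x. x \<in> elts d \<Longrightarrow> f x \<in> elts b"
    using regular_cardinal_no_cofinal[OF reg assms(2), of f] f(1) by blast
  then obtain x y where xy: "x \<in> elts d" "y \<in> elts k" "y \<notin> elts d" "linked F x y" "b \<in> elts y"
    using assms(1) unfolding codes_cofinal_map_def by blast
  then have y: "y \<in> elts (f x) \<or> y = f x" using f(2)[of x] unfolding values_bounded_def by blast
  have "Ord b" using reg b(1) Ord_mem Card_Ord unfolding regular_cardinal_def by blast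
  with y b(2)[OF xy(1)] have "y \<in> elts b" using Ord_trans by blast
  with xy(5) show False using mem_asym by blast
qed

lemma codes_injection_lepoll:
  assumes "codes_injection F m k"
  shows "elts k - elts m \<lesssim> elts m"
proof (rule lepoll_relational_full)
  let ?R = "\<lambda>z x. linked F x z \<and> (\<forall>y\<in>elts k. y \<in> elts m \<or> y = x \<or> \<not> linked F y z)"
  show "\<exists>z. z \<in> elts m \<and> ?R z x" if "x \<in> elts k - elts m" for x
    using that assms unfolding codes_injection_def by blast
  show "x = x'" if "x \<in> elts k - elts m" "x' \<in> elts k - elts m" "?R z x" "?R z x'" for z x x'
    using that by blast
qed

lemma codes_injection_Pow_lepoll:
  assumes "codes_injection_Pow F m k"
  shows "elts k - elts m \<lesssim> Pow (elts m)"
proof -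
  have "inj_on (\<lambda>x. {z \<in> elts m. linked F x z}) (elts k - elts m)"
    using assms unfolding codes_injection_Pow_def by (intro inj_onI) blast
  then show ?thesis unfolding lepoll_def by blast
qed

text \<open>Undoes the restriction of codes to \<open>k - m\<close>: the missing part
  \<open>m\<close> embeds into the target anyway.\<close>

lemma Diff_lepoll_imp_lepoll:
  assumes "infinite A" "B \<lesssim> Z" "A - B \<lesssim> Z"
  shows "A \<lesssim> Z"
proof -
  have "infinite Z"
  proof
    assume "finite Z"
    then have "finite B" "finite (A - B)" using assms(2,3) by (auto simp: lepoll_iff intro: finite_surj)
    then show False using assms(1) by simp
  qed
  then have "(A - B) \<union> B \<lesssim> Z" by (intro Un_lepoll_infinite assms)
  moreover have "A \<subseteq> (A - B) \<union> B" by blast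
  ultimately show ?thesis using lepoll_trans[OF subset_imp_lepoll] by blast
qed

lemma codes_injection_not_Card:
  assumes "codes_injection F m k" "m \<in> elts k" "infinite (elts k)"
  shows "\<not> Card k"
proof
  assume "Card k"
  have "elts k \<lesssim> elts m"
    by (rule Diff_lepoll_imp_lepoll[OF assms(3) lepoll_refl codes_injection_lepoll[OF assms(1)]])
  from lesspoll_trans1[OF this Card_mem_lesspoll[OF \<open>Card k\<close> assms(2)]] show False by simp
qed

lemma codes_injection_Pow_not_strong_limit:
  assumes "codes_injection_Pow F m k" "m \<in> elts k"
  shows "\<not> strong_limit_cardinal k"
proof
  assume k: "strong_limit_cardinal k"
  then have "infinite (elts k)" by (simp add: strong_limit_cardinal_def)
  then have "elts k \<lesssim> Pow (elts m)"
    by (rule Diff_lepoll_imp_lepoll[OF _ lepoll_Pow_self codes_injection_Pow_lepoll[OF assms(1)]])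
  from lesspoll_trans1[OF this strong_limit_Pow[OF k assms(2)]] show False by simp
qed


section \<open>Failures of regularity, of the strong limit property and of stationarity as
  formulas\<close>

definition "fm_singular = BEx 1 0 (Exists 2 fm_cofinal_map)"
definition "fm_not_strong_limit = BEx 1 0 (Exists 2 fm_injection_Pow)"

text \<open>Only the matrix is absolute; the code \<open>F\<close> must be found in
  \<open>A\<close>. Truth in M therefore yields a real code, while truth in H(\<theta>) requires a
  code that belongs to H(\<theta>).\<close>

lemma sat_BEx_Exists:
  assumes "transitive_class A" "range e \<subseteq> A" "delta0 \<phi>"
    "\<And>e. sat UNIV \<phi> e \<longleftrightarrow> P (e 2) (e 1) (e 0)"
  shows "sat A (BEx 1 0 (Exists 2 \<phi>)) e \<longleftrightarrow> (\<exists>d\<in>elts (e 0). \<exists>F\<in>A. P F d (e 0))"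
proof -
  have e0: "e 0 \<in> A" using assms(2) by auto
  have "sat A \<phi> (e(1 := d, 2 := F)) \<longleftrightarrow> P F d (e 0)" if "d \<in> elts (e 0)" "F \<in> A" for d F
  proof -
    have "d \<in> A" using assms(1) e0 that(1) by (auto simp: transitive_class_def)
    then have "range (e(1 := d, 2 := F)) \<subseteq> A" using assms(2) that(2) by auto
    from delta0_absolute[OF assms(3,1) this] show ?thesis by (simp add: assms(4))
  qed
  then show ?thesis using sat_BEx[of 0 1 A e] assms(1) e0 by simp
qed

lemmas sat_singular = sat_BEx_Exists[of _ _ fm_cofinal_map codes_cofinal_map,
    OF _ _ delta0_fms(2) sat_fm_cofinal_map, folded fm_singular_def]
lemmas sat_not_strong_limit = sat_BEx_Exists[of _ _ fm_injection_Pow codes_injection_Pow,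
    OF _ _ delta0_fms(4) sat_fm_injection_Pow, folded fm_not_strong_limit_def]

text \<open>Here variable 20 is the cardinal and variable 21 the club.\<close>

definition "fm_unbounded = BAll 22 20 (BEx 23 21 (Conj (Mem 23 20) (Mem 22 23)))"

text \<open>A nonempty ordinal in which the club is unbounded is automatically a limit, so
  nonemptiness takes the place of \<open>limit_Ord\<close>.\<close>

definition "fm_closed = BAll 22 20 (Disj (Neg (BEx 23 22 (Equal 23 23)))
  (Disj (Neg (BAll 23 22 (BEx 24 21 (Conj (Mem 24 22) (Mem 23 24))))) (Mem 22 21)))"

lemma not_lesspoll_imp_lepoll: "\<not> A \<prec> B \<Longrightarrow> B \<lesssim> A"
  using ordLeq_total[OF card_of_Well_order card_of_Well_order, of A B]
  by (metis card_of_ordLeq lepoll_def lepoll_iff_leqpoll eqpoll_imp_lepoll eqpoll_sym)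

section \<open>Consequences of small embeddings\<close>

text \<open>The second assumption says how large \<open>t\<close> has to be: H(t) then contains
  \<open>k\<close>, its elements, all its subsets, and every set of unordered pairs from
  \<open>k\<close>.\<close>

locale large_small_embedding =
  fixes k t M :: "'a::zfc" and j :: "'a \<Rightarrow> 'a"
  assumes small_embedding: "small_embedding k t M j"
    and subsets_H: "\<And>x. elts x \<subseteq> elts k \<union> {p. elts p \<subseteq> elts k} \<Longrightarrow> x \<in> H t"
begin

definition \<alpha> where "\<alpha> = crit (elts M) j"

lemma Card_k: "Card k" and Ord_k: "Ord k" and trans_M: "transitive_class (elts M)" and j_crit: "j \<alpha> = k"
  and j_H: "x \<in> elts M \<Longrightarrow> j x \<in> H t"
  using small_embedding by (auto simp: small_embedding_def \<alpha>_def Card_Ord elementary_embedding_def)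

lemma elementary: "range e \<subseteq> elts M \<Longrightarrow> sat (elts M) \<phi> e \<longleftrightarrow> sat (H t) \<phi> (j \<circ> e)"
  using small_embedding by (simp add: small_embedding_def elementary_embedding_def)

lemma elementary_delta0:
  assumes "delta0 \<phi>" "range e \<subseteq> elts M"
  shows "sat UNIV \<phi> e \<longleftrightarrow> sat UNIV \<phi> (j \<circ> e)"
proof -
  have "range (j \<circ> e) \<subseteq> H t" using j_H assms(2) by auto
  then show ?thesis
    using elementary[OF assms(2), of \<phi>] delta0_absolute[OF assms(1) trans_M assms(2)]
      delta0_absolute[OF assms(1) transitive_H[of t], of "j \<circ> e"] by simp
qed

lemma j_mem: "x \<in> elts M \<Longrightarrow> y \<in> elts M \<Longrightarrow> x \<in> elts y \<Longrightarrow> j x \<in> elts (j y)"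
  using elementary_delta0[OF delta0.Mem, of "(\<lambda>_. x)(1 := y)" 0 1] by auto

lemma crit_mem: "\<alpha> \<in> elts M" "Ord \<alpha>" "\<alpha> \<in> elts k"
  and crit_least: "b \<in> elts \<alpha> \<Longrightarrow> \<not> (b \<in> elts M \<and> b \<in> elts (j b))"
proof -
  let ?P = "\<lambda>a. a \<in> elts M \<and> a \<in> elts (j a)"
  obtain a where a: "Ord a" "?P a"
    using small_embedding by (auto simp: small_embedding_def nontrivial_embedding_def)
  note l = least_Ord[of a ?P, OF this, folded crit_def \<alpha>_def]
  from l(1,2) j_crit show "\<alpha> \<in> elts M" "Ord \<alpha>" "\<alpha> \<in> elts k" by auto
  from l(3) show "b \<in> elts \<alpha> \<Longrightarrow> \<not> ?P b" .
qed

lemma crit_subset: "elts \<alpha> \<subseteq> elts M" "elts \<alpha> \<subseteq> elts k"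
  using crit_mem trans_M Ord_elts_subset[OF Ord_k] by (auto simp: transitive_class_def)

text \<open>By induction, \<open>j\<close> fixes the elements of \<open>b\<close>, so
  \<open>b\<close> is contained in \<open>j b\<close>; minimality of the critical point excludes
  that \<open>j b\<close> is larger.\<close>

lemma j_id: "b \<in> elts \<alpha> \<Longrightarrow> j b = b"
proof (induction b rule: mem_induct)
  case (step b)
  have bM: "b \<in> elts M" using step.prems crit_subset by blast
  have "j b \<in> elts k" using j_mem[OF bM crit_mem(1) step.prems] j_crit by simp
  then have o: "Ord (j b)" "Ord b" using Ord_mem[OF Ord_k] Ord_mem[OF crit_mem(2) step.prems] by auto
  have "elts b \<subseteq> elts (j b)"
  proof
    fix c assume c: "c \<in> elts b"
    then have ca: "c \<in> elts \<alpha>" using Ord_trans[OF crit_mem(2) step.prems] by blast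
    then have "c \<in> elts M" using crit_subset by blast
    from j_mem[OF this bM c] step.IH[OF c ca] show "c \<in> elts (j b)" by simp
  qed
  moreover have "b \<notin> elts (j b)" using crit_least[OF step.prems] bM by blast
  ultimately show ?case using Ord_not_mem_iff[OF o(2,1)] by (intro extensionality) auto
qed

lemma elts_k_H: "x \<in> elts k \<Longrightarrow> x \<in> H t" and k_H: "k \<in> H t"
  using subsets_H Ord_elts_subset[OF Ord_k] by blast+

text \<open>In \<open>k\<close> the ordinal \<open>\<alpha>\<close> itself witnesses nonemptiness
  and lies above each \<open>b < \<alpha>\<close>. Since \<open>j b = b\<close>, elementarity gives
  corresponding witnesses below \<open>\<alpha>\<close>.\<close>

lemma limit_crit: "limit_Ord \<alpha>"
  unfolding limit_Ord_def
proof (intro conjI ballI)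
  show "Ord \<alpha>" by (rule crit_mem)
  have "sat UNIV (BEx 1 0 (Equal 1 1)) (\<lambda>_. \<alpha>)"
    by (subst elementary_delta0) (use crit_mem j_crit in \<open>auto intro: delta0_intros\<close>)
  then show "elts \<alpha> \<noteq> {}" by auto
  fix b assume b: "b \<in> elts \<alpha>"
  have "sat UNIV (BEx 2 1 (Mem 0 2)) ((\<lambda>_. \<alpha>)(0 := b))"
    by (subst elementary_delta0)
      (use b crit_mem j_crit j_id[OF b] crit_subset in \<open>auto intro: delta0_intros\<close>)
  then show "\<exists>c\<in>elts \<alpha>. b \<in> elts c" by simp
qed

lemma uncountable_k: "uncountable (elts k)"
  using Card_uncountable[OF Card_k crit_mem(3) limit_Ord_infinite[OF limit_crit]] .

lemma limit_k: "limit_Ord k"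
  using infinite_Card_limit[OF Card_k] uncountable_k countable_finite by blast

text \<open>The source of all codes in H(t): a set of unordered pairs from \<open>k\<close> falls
  under \<open>subsets_H\<close>, and disjointness recovers which member of a pair is which.\<close>

lemma exists_linked:
  assumes "X \<subseteq> elts k" "Y \<subseteq> elts k" "X \<inter> Y = {}"
  shows "\<exists>F\<in>H t. \<forall>x\<in>X. \<forall>y\<in>Y. linked F x y \<longleftrightarrow> R x y"
proof -
  define Z where "Z = {p. \<exists>x\<in>X. \<exists>y\<in>Y. R x y \<and> elts p = {x, y}}"
  have Z: "Z \<subseteq> {p. elts p \<subseteq> elts k}" using assms by (auto simp: Z_def)
  then have F: "elts (vset Z) = Z" by (intro elts_vset small_subset[OF small_Pow])
  have "linked (vset Z) x y \<longleftrightarrow> R x y" if xy: "x \<in> X" "y \<in> Y" for x y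
  proof
    assume "linked (vset Z) x y"
    then obtain p where "p \<in> Z" "x \<in> elts p" "y \<in> elts p" unfolding linked_def F by blast
    then obtain x' y' where p: "x' \<in> X" "y' \<in> Y" "R x' y'" "x \<in> {x', y'}" "y \<in> {x', y'}"
      unfolding Z_def by blast
    then have "x = x'" "y = y'" using xy assms(3) by auto
    with p show "R x y" by simp
  next
    assume "R x y"
    then have "vset {x, y} \<in> Z" using xy by (auto simp: Z_def small_doubleton)
    then show "linked (vset Z) x y"
      unfolding linked_def F by (rule bexI[rotated]) (simp add: small_doubleton)
  qed
  moreover have "vset Z \<in> H t" by (rule subsets_H) (use F Z in auto)
  ultimately show ?thesis by blast
qed

lemma sat_H_singular:
  assumes "range e \<subseteq> H t" "elts (e 0) \<subseteq> elts k" "limit_Ord (e 0)"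
  shows "sat (H t) fm_singular e \<longleftrightarrow> \<not> regular_cardinal (e 0)"
proof
  assume "sat (H t) fm_singular e"
  then show "\<not> regular_cardinal (e 0)"
    using codes_cofinal_map_not_regular by (auto simp: sat_singular[OF transitive_H assms(1)])
next
  define m where "m = e 0"
  have m: "limit_Ord m" "Ord m" "elts m \<subseteq> elts k" using assms by (auto simp: m_def limit_Ord_def)
  assume "\<not> regular_cardinal (e 0)"
  then obtain d f where d: "d \<in> elts m" "f ` elts d \<subseteq> elts m"
    "\<And>b. b \<in> elts m \<Longrightarrow> \<exists>x\<in>elts d. b \<in> elts (f x)"
    using singular_cofinal_map[OF m(1)] by (auto simp: m_def)
  \<comment> \<open>Values that fall into \<open>d\<close> are raised to \<open>d\<close> itself,
    which lies outside \<open>d\<close>. Raising values keeps the map cofinal and makes its range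
    disjoint from its domain.\<close>
  define g where "g x = (if f x \<in> elts d then d else f x)" for x
  have g: "g x \<in> elts m" "g x \<notin> elts d" if "x \<in> elts d" for x
    using that d(1,2) mem_irrefl[of d] by (auto simp: g_def)
  have sub: "elts d \<subseteq> elts m" using Ord_elts_subset[OF m(2) d(1)] .
  obtain F where F: "F \<in> H t" "\<And>x y. x \<in> elts d \<Longrightarrow> y \<in> elts m - elts d \<Longrightarrow> linked F x y \<longleftrightarrow> y = g x"
    using exists_linked[of "elts d" "elts m - elts d" "\<lambda>x y. y = g x"] sub m(3) by blast
  have "codes_cofinal_map F d m"
    unfolding codes_cofinal_map_def
  proof (intro conjI ballI)
    fix b assume "b \<in> elts m"
    then obtain x where x: "x \<in> elts d" "b \<in> elts (f x)" using d(3) by blast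
    have "Ord d" using Ord_mem[OF m(2) d(1)] .
    then have "b \<in> elts (g x)" using x(2) Ord_trans[of d "f x" b] by (auto simp: g_def)
    moreover have "linked F x (g x)" using F(2)[OF x(1)] g[OF x(1)] by blast
    ultimately show "\<exists>x\<in>elts d. \<exists>y\<in>elts m. y \<notin> elts d \<and> linked F x y \<and> b \<in> elts y"
      using x(1) g[OF x(1)] by blast
  next
    fix x assume x: "x \<in> elts d"
    have "values_bounded F d m x (g x)" using F(2)[OF x] by (auto simp: values_bounded_def)
    with g(1)[OF x] show "\<exists>y\<in>elts m. values_bounded F d m x y" by blast
  qed
  with d(1) F(1) show "sat (H t) fm_singular e"
    by (auto simp: sat_singular[OF transitive_H assms(1)] m_def)
qed

lemma sat_H_not_strong_limit:
  assumes "range e \<subseteq> H t" "elts (e 0) \<subseteq> elts k" "Card (e 0)" "infinite (elts (e 0))"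
  shows "sat (H t) fm_not_strong_limit e \<longleftrightarrow> \<not> strong_limit_cardinal (e 0)"
proof
  assume "sat (H t) fm_not_strong_limit e"
  then show "\<not> strong_limit_cardinal (e 0)"
    using codes_injection_Pow_not_strong_limit by (auto simp: sat_not_strong_limit[OF transitive_H assms(1)])
next
  define m where "m = e 0"
  assume "\<not> strong_limit_cardinal (e 0)"
  then obtain n where n: "n \<in> elts m" "\<not> Pow (elts n) \<prec> elts m"
    using assms(3,4) by (auto simp: strong_limit_cardinal_def m_def)
  from not_lesspoll_imp_lepoll[OF n(2)] obtain f where f: "inj_on f (elts m)" "f ` elts m \<subseteq> Pow (elts n)"
    by (auto simp: lepoll_def)
  have sub: "elts n \<subseteq> elts m" using Ord_elts_subset[of m n] n(1) assms(3) Card_Ord by (auto simp: m_def)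
  obtain F where F: "F \<in> H t" "\<And>x z. x \<in> elts m - elts n \<Longrightarrow> z \<in> elts n \<Longrightarrow> linked F x z \<longleftrightarrow> z \<in> f x"
    using exists_linked[of "elts m - elts n" "elts n" "\<lambda>x z. z \<in> f x"] sub assms(2)[folded m_def] by blast
  have "codes_injection_Pow F n m"
    unfolding codes_injection_Pow_def
  proof (intro ballI, rule ccontr)
    fix x y assume xy: "x \<in> elts m" "y \<in> elts m"
      and *: "\<not> (x \<in> elts n \<or> y \<in> elts n \<or> x = y \<or> (\<exists>z\<in>elts n. \<not> (linked F x z \<longleftrightarrow> linked F y z)))"
    then have "f x \<inter> elts n = f y \<inter> elts n" using F(2)[of x] F(2)[of y] by blast
    then have "f x = f y" using f(2) xy by blast
    with xy * f(1) show False by (auto dest: inj_onD)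
  qed
  with n(1) F(1) show "sat (H t) fm_not_strong_limit e"
    by (auto simp: sat_not_strong_limit[OF transitive_H assms(1)] m_def)
qed

lemma regular_k: "regular_cardinal k"
  \<comment> \<open>The image under \<open>j\<close> of a cofinal map \<open>d \<rightarrow> \<alpha>\<close> still has its values below \<open>\<alpha>\<close>.\<close>
proof (rule ccontr)
  assume "\<not> regular_cardinal k"
  then have "sat (H t) fm_singular (\<lambda>_. k)"
    by (subst sat_H_singular) (use k_H limit_k in auto)
  then have "sat (elts M) fm_singular (\<lambda>_. \<alpha>)"
    using elementary[of "\<lambda>_. \<alpha>"] crit_mem(1) j_crit by (auto simp: o_def)
  moreover have "range (\<lambda>_::nat. \<alpha>) \<subseteq> elts M" using crit_mem(1) by auto
  ultimately obtain d F where d: "d \<in> elts \<alpha>" "F \<in> elts M" "codes_cofinal_map F d \<alpha>"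
    using sat_singular[OF trans_M, of "\<lambda>_. \<alpha>"] by auto
  have dM: "d \<in> elts M" using d(1) crit_subset by blast
  have bounded: "values_bounded (j F) d k x y"
    if "x \<in> elts d" "y \<in> elts \<alpha>" "values_bounded F d \<alpha> x y" for x y
  proof -
    have xy: "x \<in> elts \<alpha>" "y \<in> elts \<alpha>" using Ord_trans[OF crit_mem(2) d(1)] that by auto
    let ?e = "(\<lambda>_. \<alpha>)(1 := d, 2 := F, 3 := x, 4 := y)"
    have "range ?e \<subseteq> elts M" using xy crit_subset d(2) dM crit_mem(1) by auto
    from elementary_delta0[OF delta0_fms(1) this] show ?thesis
      using that(3) j_id[OF d(1)] j_id[OF xy(1)] j_id[OF xy(2)] j_crit by (simp add: sat_fm_values_bounded)
  qed
  have "codes_cofinal_map (j F) d k"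
  proof -
    let ?e = "(\<lambda>_. \<alpha>)(1 := d, 2 := F)"
    have "range ?e \<subseteq> elts M" using d(2) dM crit_mem(1) by auto
    from elementary_delta0[OF delta0_fms(2) this] show ?thesis
      using d(3) j_id[OF d(1)] j_crit by (simp add: sat_fm_cofinal_map)
  qed
  then obtain x z where x: "x \<in> elts d" "z \<in> elts k" "z \<notin> elts d" "linked (j F) x z" "\<alpha> \<in> elts z"
    using crit_mem(3) unfolding codes_cofinal_map_def by blast
  obtain y where y: "y \<in> elts \<alpha>" "values_bounded F d \<alpha> x y"
    using d(3) x(1) unfolding codes_cofinal_map_def by blast
  from bounded[OF x(1) y] x(2-4) have "z \<in> elts y \<or> z = y" unfolding values_bounded_def by blast
  then have "z \<in> elts \<alpha>" using y(1) Ord_trans[OF crit_mem(2) y(1)] by blast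
  with x(5) mem_asym show False by blast
qed

text \<open>If the cardinals below \<open>k\<close> were bounded, some \<open>m < k\<close> would
  receive injections from all ordinals below \<open>k\<close>. By elementarity some
  \<open>n < \<alpha>\<close> has this property in M for \<open>\<alpha>\<close>, and as
  \<open>j n = n\<close>, in H(t) for \<open>k\<close>. Since \<open>\<alpha> < k\<close>, also
  \<open>\<alpha>\<close> injects into \<open>n\<close>, so it is no cardinal.\<close>

lemma limit_cardinal_k:
  assumes "Card \<alpha>"
  shows "limit_cardinal k"
proof (rule ccontr)
  assume "\<not> limit_cardinal k"
  moreover have "infinite (elts k)" using uncountable_k countable_finite by blast
  ultimately obtain m where m: "m \<in> elts k" "\<And>n. n \<in> elts k \<Longrightarrow> Card n \<Longrightarrow> m \<notin> elts n"
    using Card_k unfolding limit_cardinal_def by blast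
  have "Ord m" using Ord_mem[OF Ord_k m(1)] .
  have "\<exists>F\<in>H t. codes_injection F m n" if n: "n \<in> elts k" for n
  proof -
    obtain c where c: "Card c" "elts c \<approx> elts n" "elts c \<subseteq> elts n"
      using Ord_eqpoll_Card[OF Ord_mem[OF Ord_k n]] by metis
    have "c \<in> elts k" using Ord_subset_mem_trans[OF Ord_k Card_Ord[OF c(1)] c(3) n] .
    then have "elts c \<subseteq> elts m"
      using m(2) c(1) Ord_not_mem_iff[OF \<open>Ord m\<close> Card_Ord[OF c(1)]] by blast
    then have "elts n \<lesssim> elts m" using lepoll_trans1[OF eqpoll_sym[OF c(2)] subset_imp_lepoll] by blast
    then obtain f where f: "inj_on f (elts n)" "f ` elts n \<subseteq> elts m" by (auto simp: lepoll_def)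
    have sub: "elts n \<subseteq> elts k" "elts m \<subseteq> elts k" using Ord_elts_subset[OF Ord_k] n m(1) by auto
    obtain F where F: "F \<in> H t" "\<And>x z. x \<in> elts n - elts m \<Longrightarrow> z \<in> elts m \<Longrightarrow> linked F x z \<longleftrightarrow> z = f x"
      using exists_linked[of "elts n - elts m" "elts m" "\<lambda>x z. z = f x"] sub by blast
    have "codes_injection F m n"
      unfolding codes_injection_def
    proof (intro ballI disjCI)
      fix x assume x: "x \<in> elts n" and *: "\<not> (\<exists>z\<in>elts m. linked F x z \<and> (\<forall>y\<in>elts n. y \<in> elts m \<or> y = x \<or> \<not> linked F y z))"
      show "x \<in> elts m"
      proof (rule ccontr)
        assume xm: "x \<notin> elts m"
        have fx: "f x \<in> elts m" using f(2) x by blast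
        have "y \<in> elts m \<or> y = x \<or> \<not> linked F y (f x)" if "y \<in> elts n" for y
          using F(2)[of y "f x"] fx that inj_onD[OF f(1), of x y] x by auto
        moreover have "linked F x (f x)" using F(2)[of x "f x"] x xm fx by blast
        ultimately show False using * fx by blast
      qed
    qed
    with F(1) show ?thesis by blast
  qed
  note inj = this
  \<comment> \<open>Variable 0 now ranges over the ordinals to be injected, so the cardinal itself
    is placed in variable 7, which \<open>fm_injection\<close> does not mention.\<close>
  define \<phi> where "\<phi> = BAll 0 7 (Exists 2 fm_injection)"
  have sat_\<phi>: "sat (H t) \<phi> ((\<lambda>_. k)(1 := n)) \<longleftrightarrow> (\<forall>x\<in>elts k. \<exists>F\<in>H t. codes_injection F n x)" if "n \<in> elts k" for n
  proof -
    have "sat (H t) fm_injection ((\<lambda>_. k)(1 := n, 0 := x, 2 := F)) \<longleftrightarrow> codes_injection F n x"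
      if "x \<in> elts k" "F \<in> H t" for x F
    proof -
      have "range ((\<lambda>_. k)(1 := n, 0 := x, 2 := F)) \<subseteq> H t"
        using that \<open>n \<in> elts k\<close> elts_k_H k_H by auto
      from delta0_absolute[OF delta0_fms(3) transitive_H this] show ?thesis by (simp add: sat_fm_injection)
    qed
    then show ?thesis unfolding \<phi>_def by (subst sat_BAll) (use transitive_H k_H in auto)
  qed
  have "sat (H t) (BEx 1 7 \<phi>) (\<lambda>_. k)"
    by (subst sat_BEx) (use transitive_H k_H inj m(1) sat_\<phi> in auto)
  then have "sat (elts M) (BEx 1 7 \<phi>) (\<lambda>_. \<alpha>)"
    using elementary[of "\<lambda>_. \<alpha>"] crit_mem(1) j_crit by (auto simp: o_def)
  then obtain n where n: "n \<in> elts \<alpha>" "sat (elts M) \<phi> ((\<lambda>_. \<alpha>)(1 := n))"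
    using sat_BEx[of 7 1 "elts M" "\<lambda>_. \<alpha>" \<phi>] trans_M crit_mem(1) by auto
  have r: "range ((\<lambda>_::nat. \<alpha>)(1 := n)) \<subseteq> elts M" using n(1) crit_mem(1) crit_subset by auto
  have je: "j \<circ> (\<lambda>_. \<alpha>)(1 := n) = (\<lambda>_. k)(1 := n)" using j_crit j_id[OF n(1)] by auto
  from elementary[OF r, of \<phi>] n(2) have "sat (H t) \<phi> ((\<lambda>_. k)(1 := n))" unfolding je by blast
  then obtain F where "codes_injection F n \<alpha>" using sat_\<phi>[of n] n(1) crit_subset crit_mem(3) by blast
  from codes_injection_not_Card[OF this n(1) limit_Ord_infinite[OF limit_crit]] assms show False by blast
qed

text \<open>No comparison with \<open>j(F)\<close> is needed here: a code in M for an injection of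
  \<open>\<alpha>\<close> into the power set of some \<open>m < \<alpha>\<close> is one in
  V.\<close>

lemma strong_limit_k:
  assumes "strong_limit_cardinal \<alpha>"
  shows "strong_limit_cardinal k"
proof (rule ccontr)
  assume "\<not> strong_limit_cardinal k"
  then have "sat (H t) fm_not_strong_limit (\<lambda>_. k)"
    by (subst sat_H_not_strong_limit) (use k_H Card_k uncountable_k countable_finite in auto)
  then have "sat (elts M) fm_not_strong_limit (\<lambda>_. \<alpha>)"
    using elementary[of "\<lambda>_. \<alpha>"] crit_mem(1) j_crit by (auto simp: o_def)
  moreover have "range (\<lambda>_::nat. \<alpha>) \<subseteq> elts M" using crit_mem(1) by auto
  ultimately obtain m F where "m \<in> elts \<alpha>" "codes_injection_Pow F m \<alpha>"
    using sat_not_strong_limit[OF trans_M, of "\<lambda>_. \<alpha>"] by auto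
  with codes_injection_Pow_not_strong_limit assms show False by blast
qed

text \<open>
  A club \<open>C \<in> M\<close> of bad points of \<open>\<alpha>\<close> satisfies \<open>C \<subseteq> j(C)\<close>, so \<open>\<alpha>\<close> is a limit of the
  closed set \<open>j(C)\<close> and hence bad itself.
\<close>

lemma stationary_k:
  assumes \<chi>: "\<And>e. range e \<subseteq> H t \<Longrightarrow> e 0 \<in> elts k \<Longrightarrow> sat (H t) \<chi> e \<longleftrightarrow> \<not> Q (e 0)"
    and "Q \<alpha>"
  shows "stationary_in {m \<in> elts k. Q m} k"
proof (rule ccontr)
  assume "\<not> ?thesis"
  then obtain S where S: "club_in S k" "\<And>m. m \<in> S \<Longrightarrow> m \<in> elts k \<Longrightarrow> \<not> Q m"
    unfolding stationary_in_def by blast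
  have Sk: "S \<subseteq> elts k" using S(1) by (simp add: club_in_def)
  have "small S" by (rule small_subset[OF small_elts Sk])
  then obtain C where C: "elts C = S" by (auto simp: small_def)
  have CH: "C \<in> H t" by (rule subsets_H) (use C Sk in auto)
  define \<psi> where "\<psi> = BAll 0 21 (Disj (Neg (Mem 0 20)) \<chi>)"
  have d0: "delta0 fm_unbounded" "delta0 fm_closed"
    unfolding fm_unbounded_def fm_closed_def by (intro delta0_intros; simp)+
  \<comment> \<open>The set \<open>C\<close> need not be in the range of \<open>j\<close>. What
    passes to M is that some club of bad points exists, and the club \<open>D\<close> obtained there
    is unrelated to \<open>C\<close>.\<close>
  let ?\<Phi> = "Exists 21 (Conj fm_unbounded (Conj fm_closed \<psi>))"
  have "sat (H t) ?\<Phi> (\<lambda>_. k)"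
    unfolding sat.simps
  proof (intro bexI[OF _ CH] conjI)
    let ?e = "(\<lambda>_. k)(21 := C)"
    have r: "range ?e \<subseteq> H t" using CH k_H by auto
    show "sat (H t) fm_unbounded ?e"
      unfolding delta0_absolute[OF d0(1) transitive_H r]
      using S(1) C by (auto simp: fm_unbounded_def club_in_def unbounded_in_def)
    show "sat (H t) fm_closed ?e"
      unfolding delta0_absolute[OF d0(2) transitive_H r]
    proof -
      have "g \<in> S" if g: "g \<in> elts k" "elts g \<noteq> {}" "\<forall>x\<in>elts g. \<exists>y\<in>S. y \<in> elts g \<and> x \<in> elts y" for g
      proof -
        have "limit_Ord g" using g Ord_mem[OF Ord_k] unfolding limit_Ord_def by blast
        moreover have "unbounded_in S g" using g(3) unfolding unbounded_in_def by blast
        ultimately show ?thesis using S(1) g(1) unfolding club_in_def by blast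
      qed
      then show "sat UNIV fm_closed ?e" by (simp add: fm_closed_def C) blast
    qed
    show "sat (H t) \<psi> ?e"
      unfolding \<psi>_def
    proof (subst sat_BAll)
      show "\<forall>x\<in>elts (?e 21). sat (H t) (Disj (Neg (Mem 0 20)) \<chi>) (?e(0 := x))"
      proof
        fix x assume "x \<in> elts (?e 21)"
        then have x: "x \<in> S" using C by simp
        then have xk: "x \<in> elts k" using Sk by blast
        have "range (?e(0 := x)) \<subseteq> H t" using r elts_k_H[OF xk] by auto
        from \<chi>[OF this] xk S(2)[OF x xk] have "sat (H t) \<chi> (?e(0 := x))" by simp
        then show "sat (H t) (Disj (Neg (Mem 0 20)) \<chi>) (?e(0 := x))" by simp
      qed
    qed (use transitive_H CH in auto)
  qed
  then have "sat (elts M) ?\<Phi> (\<lambda>_. \<alpha>)"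
    using elementary[of "\<lambda>_. \<alpha>"] crit_mem(1) j_crit by (auto simp: o_def simp del: sat.simps)
  then obtain D where D: "D \<in> elts M" "sat (elts M) fm_unbounded ((\<lambda>_. \<alpha>)(21 := D))"
    "sat (elts M) fm_closed ((\<lambda>_. \<alpha>)(21 := D))" "sat (elts M) \<psi> ((\<lambda>_. \<alpha>)(21 := D))"
    by auto
  have r: "range ((\<lambda>_::nat. \<alpha>)(21 := D)) \<subseteq> elts M" using D(1) crit_mem(1) by auto
  have je: "j \<circ> (\<lambda>_. \<alpha>)(21 := D) = (\<lambda>_. k)(21 := j D)" using j_crit by auto
  have jr: "range ((\<lambda>_::nat. k)(21 := j D)) \<subseteq> H t" using j_H[OF D(1)] k_H by auto
  have unb: "\<exists>c\<in>elts D. c \<in> elts \<alpha> \<and> b \<in> elts c" if "b \<in> elts \<alpha>" for b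
    using D(2) that unfolding delta0_absolute[OF d0(1) trans_M r] by (simp add: fm_unbounded_def)
  have jD: "\<exists>y\<in>elts (j D). y \<in> elts \<alpha> \<and> b \<in> elts y" if "b \<in> elts \<alpha>" for b
  proof -
    from unb[OF that] obtain c where c: "c \<in> elts D" "c \<in> elts \<alpha>" "b \<in> elts c" by blast
    then have "c \<in> elts M" using crit_subset by blast
    from j_mem[OF this D(1) c(1)] j_id[OF c(2)] have "c \<in> elts (j D)" by simp
    with c show ?thesis by blast
  qed
  have "sat UNIV fm_closed ((\<lambda>_. k)(21 := j D))"
    using D(3) elementary[OF r] delta0_absolute[OF d0(2) transitive_H jr] by (simp add: je)
  then have "elts \<alpha> = {} \<or> (\<exists>b\<in>elts \<alpha>. \<forall>y\<in>elts (j D). y \<in> elts \<alpha> \<longrightarrow> b \<notin> elts y) \<or> \<alpha> \<in> elts (j D)"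
    using crit_mem(3) by (simp add: fm_closed_def)
  moreover have "elts \<alpha> \<noteq> {}" using limit_crit by (simp add: limit_Ord_def)
  ultimately have "\<alpha> \<in> elts (j D)" using jD by blast
  moreover have "sat (H t) \<psi> ((\<lambda>_. k)(21 := j D))" using D(4) elementary[OF r] by (simp add: je)
  ultimately have "sat (H t) (Disj (Neg (Mem 0 20)) \<chi>) ((\<lambda>_. k)(21 := j D, 0 := \<alpha>))"
    unfolding \<psi>_def using transitive_H[of t] j_H[OF D(1)] by (subst (asm) sat_BAll) auto
  then have "sat (H t) \<chi> ((\<lambda>_. k)(21 := j D, 0 := \<alpha>))" using crit_mem(3) by simp
  moreover have "range ((\<lambda>_::nat. k)(21 := j D, 0 := \<alpha>)) \<subseteq> H t" using jr elts_k_H[OF crit_mem(3)] by auto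
  from \<chi>[OF this] crit_mem(3) \<open>Q \<alpha>\<close> have "\<not> sat (H t) \<chi> ((\<lambda>_. k)(21 := j D, 0 := \<alpha>))" by simp
  ultimately show False by simp
qed

lemma sat_H_limit:
  assumes "range e \<subseteq> H t" "e n \<in> elts k" "n < 8"
  shows "sat (H t) (fm_limit n) e \<longleftrightarrow> limit_Ord (e n)"
  using delta0_absolute[OF delta0_fms(5)[OF assms(3)] transitive_H assms(1)] sat_fm_limit[of n e]
    Ord_mem[OF Ord_k assms(2)] assms(3) by simp

lemma weakly_Mahlo_k:
  assumes "regular_cardinal \<alpha>"
  shows "weakly_Mahlo k"
proof -
  have "stationary_in {m \<in> elts k. regular_cardinal m} k"
  \<comment> \<open>\<open>sat_H_singular\<close> interprets \<open>fm_singular\<close> at limit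
    ordinals only, so non-limits are declared bad by a separate disjunct.\<close>
  proof (rule stationary_k[where \<chi> = "Disj (Neg (fm_limit 0)) fm_singular"])
    fix e :: "nat \<Rightarrow> 'a" assume e: "range e \<subseteq> H t" "e 0 \<in> elts k"
    have "regular_cardinal (e 0) \<Longrightarrow> limit_Ord (e 0)"
      using infinite_Card_limit by (auto simp: regular_cardinal_def)
    then show "sat (H t) (Disj (Neg (fm_limit 0)) fm_singular) e \<longleftrightarrow> \<not> regular_cardinal (e 0)"
      using sat_H_singular[OF e(1) Ord_elts_subset[OF Ord_k e(2)]] sat_H_limit[OF e] by auto
  qed fact
  then show ?thesis using regular_k uncountable_k by (simp add: weakly_Mahlo_def)
qed

lemma Mahlo_k:
  assumes "inaccessible \<alpha>"
  shows "Mahlo k"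
proof -
  \<comment> \<open>The disjunct with variable 7 expresses countability: a regular cardinal is
    uncountable exactly if some limit ordinal lies below it.\<close>
  let ?\<chi> = "Disj (Neg (fm_limit 0)) (Disj fm_singular
    (Disj (Neg (BEx 7 0 (fm_limit 7))) fm_not_strong_limit))"
  have "stationary_in {m \<in> elts k. inaccessible m} k"
  proof (rule stationary_k[where \<chi> = ?\<chi>])
    fix e :: "nat \<Rightarrow> 'a" assume e: "range e \<subseteq> H t" "e 0 \<in> elts k"
    have sub: "elts (e 0) \<subseteq> elts k" using Ord_elts_subset[OF Ord_k e(2)] .
    have "sat (H t) (fm_limit 7) (e(7 := x)) \<longleftrightarrow> limit_Ord x" if "x \<in> elts (e 0)" for x
    proof -
      have xk: "x \<in> elts k" using sub that by blast
      have "range (e(7 := x)) \<subseteq> H t" using e elts_k_H[OF xk] by auto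
      from sat_H_limit[OF this, of 7] xk show ?thesis by simp
    qed
    then have ex: "sat (H t) (BEx 7 0 (fm_limit 7)) e \<longleftrightarrow> (\<exists>x\<in>elts (e 0). limit_Ord x)"
      by (subst sat_BEx) (use transitive_H elts_k_H[OF e(2)] in auto)
    show "sat (H t) ?\<chi> e \<longleftrightarrow> \<not> inaccessible (e 0)"
    proof (cases "regular_cardinal (e 0)")
      case True
      then have c: "Card (e 0)" "infinite (elts (e 0))" by (auto simp: regular_cardinal_def)
      have l: "limit_Ord (e 0)" by (rule infinite_Card_limit[OF c])
      have "uncountable (elts (e 0)) \<longleftrightarrow> (\<exists>x\<in>elts (e 0). limit_Ord x)"
        using uncountable_Card_mem_limit[OF c(1)] Card_uncountable[OF c(1) _ limit_Ord_infinite] by blast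
      then show ?thesis
        using sat_H_not_strong_limit[OF e(1) sub c] sat_H_singular[OF e(1) sub l] sat_H_limit[OF e] l ex True
        by (simp add: inaccessible_def)
    next
      case False
      then show ?thesis
        using sat_H_singular[OF e(1) sub] sat_H_limit[OF e] by (auto simp: inaccessible_def)
    qed
  qed fact
  then show ?thesis using regular_k uncountable_k by (simp add: Mahlo_def)
qed

end

section \<open>The quantifier over large \<theta> and the five equivalences\<close>

text \<open>From right to left a single \<theta> suffices. It is taken above the given threshold and
  larger than the transitive set formed by \<open>k\<close> and the subsets of \<open>k\<close>,
  which yields \<open>subsets_H\<close>.\<close>

lemma for_large_cardinals_obtain:
  assumes "Card k" "for_large_cardinals k (\<lambda>t. \<exists>M j. small_embedding k t M j \<and> P (crit (elts M) j))"
  obtains t M j where "large_small_embedding k t M j" "P (crit (elts M) j)"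
proof -
  obtain a where a: "Ord a"
    "\<And>t. Card t \<Longrightarrow> a \<in> elts t \<Longrightarrow> \<exists>M j. small_embedding k t M j \<and> P (crit (elts M) j)"
    using assms(2) unfolding for_large_cardinals_def by blast
  let ?T = "elts k \<union> {p. elts p \<subseteq> elts k}"
  have sm: "small ?T" by (intro small_Un small_elts small_Pow)
  have tr: "transitive_class ?T"
    using Card_Ord[OF assms(1)] by (auto simp: transitive_class_def dest: Ord_trans)
  obtain t where t: "Card t" "a \<in> elts t" "?T \<prec> elts t" using exists_large_Card[OF a(1) sm] by blast
  obtain M j where Mj: "small_embedding k t M j" "P (crit (elts M) j)" using a(2)[OF t(1,2)] by blast
  have "large_small_embedding k t M j"
    by unfold_locales (use Mj(1) H_I[OF sm tr _ t(3)] in auto)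
  with Mj(2) that show ?thesis by blast
qed

text \<open>The threshold is \<open>k\<close> itself: the hull construction works in H(\<theta>) for
  every cardinal \<theta> above \<open>k\<close>.\<close>

lemma for_large_cardinals_small_embedding:
  assumes "regular_cardinal k" "uncountable (elts k)"
    and "\<And>h. h ` elts k \<subseteq> elts k \<Longrightarrow> \<exists>a\<in>closure_points h k. P a"
  shows "for_large_cardinals k (\<lambda>t. \<exists>M j. small_embedding k t M j \<and> P (crit (elts M) j))"
  unfolding for_large_cardinals_def
  using regular_small_embedding[OF assms(1,2) _ _ assms(3)] assms(1)
  by (intro exI[of _ k]) (auto simp: ord_le_def regular_cardinal_def Card_Ord)

theorem corollary2p2:
  fixes \<kappa> :: "'a::zfc"
  assumes "Card \<kappa>"
  shows
    "(uncountable (elts \<kappa>) \<and> regular_cardinal \<kappa> \<longleftrightarrow>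
        for_large_cardinals \<kappa> (\<lambda>\<theta>. \<exists>M j. small_embedding \<kappa> \<theta> M j)) \<and>
     (weakly_inaccessible \<kappa> \<longleftrightarrow>
        for_large_cardinals \<kappa> (\<lambda>\<theta>. \<exists>M j. small_embedding \<kappa> \<theta> M j \<and>
          Card (crit (elts M) j))) \<and>
     (inaccessible \<kappa> \<longleftrightarrow>
        for_large_cardinals \<kappa> (\<lambda>\<theta>. \<exists>M j. small_embedding \<kappa> \<theta> M j \<and>
          strong_limit_cardinal (crit (elts M) j))) \<and>
     (weakly_Mahlo \<kappa> \<longleftrightarrow>
        for_large_cardinals \<kappa> (\<lambda>\<theta>. \<exists>M j. small_embedding \<kappa> \<theta> M j \<and>
          regular_cardinal (crit (elts M) j))) \<and>
     (Mahlo \<kappa> \<longleftrightarrow>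
        for_large_cardinals \<kappa> (\<lambda>\<theta>. \<exists>M j. small_embedding \<kappa> \<theta> M j \<and>
          inaccessible (crit (elts M) j)))"
proof (intro conjI iffI)
  assume "uncountable (elts \<kappa>) \<and> regular_cardinal \<kappa>"
  then have "for_large_cardinals \<kappa> (\<lambda>\<theta>. \<exists>M j. small_embedding \<kappa> \<theta> M j \<and> True)"
    using closure_points_nonempty[of \<kappa>] by (intro for_large_cardinals_small_embedding) (auto simp: ex_in_conv)
  then show "for_large_cardinals \<kappa> (\<lambda>\<theta>. \<exists>M j. small_embedding \<kappa> \<theta> M j)" by simp
next
  assume "for_large_cardinals \<kappa> (\<lambda>\<theta>. \<exists>M j. small_embedding \<kappa> \<theta> M j)"
  then obtain t M j where "large_small_embedding \<kappa> t M j"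
    using for_large_cardinals_obtain[OF assms, of "\<lambda>_. True"] by auto
  then interpret large_small_embedding \<kappa> t M j .
  show "uncountable (elts \<kappa>)" "regular_cardinal \<kappa>" by (rule uncountable_k regular_k)+
next
  assume k: "weakly_inaccessible \<kappa>"
  then show "for_large_cardinals \<kappa> (\<lambda>\<theta>. \<exists>M j. small_embedding \<kappa> \<theta> M j \<and> Card (crit (elts M) j))"
    using weakly_inaccessible_closure_point_Card[OF k]
    by (intro for_large_cardinals_small_embedding) (auto simp: weakly_inaccessible_def)
next
  assume "for_large_cardinals \<kappa> (\<lambda>\<theta>. \<exists>M j. small_embedding \<kappa> \<theta> M j \<and> Card (crit (elts M) j))"
  then obtain t M j where "large_small_embedding \<kappa> t M j" and c: "Card (crit (elts M) j)"
    by (rule for_large_cardinals_obtain[OF assms])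
  then interpret large_small_embedding \<kappa> t M j by blast
  show "weakly_inaccessible \<kappa>"
    using uncountable_k regular_k limit_cardinal_k c by (simp add: weakly_inaccessible_def \<alpha>_def)
next
  assume k: "inaccessible \<kappa>"
  then show "for_large_cardinals \<kappa> (\<lambda>\<theta>. \<exists>M j. small_embedding \<kappa> \<theta> M j \<and> strong_limit_cardinal (crit (elts M) j))"
    using inaccessible_closure_point_strong_limit[OF k]
    by (intro for_large_cardinals_small_embedding) (auto simp: inaccessible_def)
next
  assume "for_large_cardinals \<kappa> (\<lambda>\<theta>. \<exists>M j. small_embedding \<kappa> \<theta> M j \<and> strong_limit_cardinal (crit (elts M) j))"
  then obtain t M j where "large_small_embedding \<kappa> t M j" and c: "strong_limit_cardinal (crit (elts M) j)"
    by (rule for_large_cardinals_obtain[OF assms])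
  then interpret large_small_embedding \<kappa> t M j by blast
  show "inaccessible \<kappa>"
    using uncountable_k regular_k strong_limit_k c by (simp add: inaccessible_def \<alpha>_def)
next
  assume k: "weakly_Mahlo \<kappa>"
  then have k': "regular_cardinal \<kappa>" "uncountable (elts \<kappa>)"
    "stationary_in {\<mu> \<in> elts \<kappa>. regular_cardinal \<mu>} \<kappa>" by (auto simp: weakly_Mahlo_def)
  show "for_large_cardinals \<kappa> (\<lambda>\<theta>. \<exists>M j. small_embedding \<kappa> \<theta> M j \<and> regular_cardinal (crit (elts M) j))"
    using club_inter_closure_points[OF k'(1,2) _ k'(3)]
    by (intro for_large_cardinals_small_embedding k') blast
next
  assume "for_large_cardinals \<kappa> (\<lambda>\<theta>. \<exists>M j. small_embedding \<kappa> \<theta> M j \<and> regular_cardinal (crit (elts M) j))"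
  then obtain t M j where "large_small_embedding \<kappa> t M j" and c: "regular_cardinal (crit (elts M) j)"
    by (rule for_large_cardinals_obtain[OF assms])
  then interpret large_small_embedding \<kappa> t M j by blast
  show "weakly_Mahlo \<kappa>" using weakly_Mahlo_k c by (simp add: \<alpha>_def)
next
  assume k: "Mahlo \<kappa>"
  then have k': "regular_cardinal \<kappa>" "uncountable (elts \<kappa>)"
    "stationary_in {\<mu> \<in> elts \<kappa>. inaccessible \<mu>} \<kappa>" by (auto simp: Mahlo_def)
  show "for_large_cardinals \<kappa> (\<lambda>\<theta>. \<exists>M j. small_embedding \<kappa> \<theta> M j \<and> inaccessible (crit (elts M) j))"
    using club_inter_closure_points[OF k'(1,2) _ k'(3)]
    by (intro for_large_cardinals_small_embedding k') blast
next
  assume "for_large_cardinals \<kappa> (\<lambda>\<theta>. \<exists>M j. small_embedding \<kappa> \<theta> M j \<and> inaccessible (crit (elts M) j))"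
  then obtain t M j where "large_small_embedding \<kappa> t M j" and c: "inaccessible (crit (elts M) j)"
    by (rule for_large_cardinals_obtain[OF assms])
  then interpret large_small_embedding \<kappa> t M j by blast
  show "Mahlo \<kappa>" using Mahlo_k c by (simp add: \<alpha>_def)
qed

end
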